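(* Let $l\in\mathbb N-\frac12$ and $\tilde{\mathfrak g}=\tilde{\mathfrak g}^{(l)}$. (i) If $M$ is a simple $\tilde{\mathcal H}^{(l)}$-module on which $z$ acts as a nonzero scalar and $N$ is a simple $\mathfrak{sl}_2$-module, then $M^{\tilde{\mathfrak g}}\otimes N^{\tilde{\mathfrak g}}$ is a simple $\tilde{\mathfrak g}$-module. (ii) Let $V$ be a simple $\tilde{\mathfrak g}$-module on which $z$ acts as a nonzero scalar $\dot z$. If the restriction of $V$ to $\tilde{\mathcal H}^{(l)}$ contains a simple $\tilde{\mathcal H}^{(l)}$-submodule $M$, then $V\cong M^{\tilde{\mathfrak g}}\otimes N^{\tilde{\mathfrak g}}$ for some simple $\mathfrak{sl}_2$-module $N$.
   Context: For $l\in\mathbb N-\frac12$, $\tilde{\mathfrak g}^{(l)}$ is the complex Lie algebra with basis $e,h,f,p_0,\dots,p_{2l},z$ and brackets $[h,e]=2e$, $[h,f]=-2f$, $[e,f]=h$, $[h,p_k]=2(l-k)p_k$, $[e,p_k]=kp_{k-1}$, $[f,p_k]=(2l-k)p_{k+1}$ ($p_{-1}=p_{2l+1}=0$), $z$ central, $[p_k,p_{k'}]=\delta_{k+k',2l}(-1)^{k+l+\frac12}k!(2l-k)!\,z$. $\tilde{\mathcal H}^{(l)}=\mathrm{span}\{p_0,\dots,p_{2l},z\}$ (an ideal), $\mathfrak{sl}_2=\mathrm{span}\{e,h,f\}$. For an $\tilde{\mathcal H}^{(l)}$-module $M$ on which $z$ acts as a nonzero scalar, $M^{\tilde{\mathfrak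 g}}$ denotes $M$ with $\tilde{\mathfrak g}$-action obtained by pulling back along the algebra homomorphism $\Phi_l:U(\tilde{\mathfrak g})\to U(\tilde{\mathcal H}^{(l)})_{(z)}$ (localization at powers of $z$) which is the identity on $\tilde{\mathcal H}^{(l)}$ and sends $e\mapsto \frac{1}{z}\sum_{k=1}^{2l}(-1)^{k+l+\frac12}\frac{l-k}{(k-1)!(2l-k)!}p_{k-1}p_{2l-k}$, $f\mapsto \frac{1}{z}\sum_{k=1}^{2l}(-1)^{k+l-\frac12}\frac{l-k}{(k-1)!(2l-k)!}p_{k}p_{2l-k+1}$, $h\mapsto \frac{2}{z}\sum_{k=0}^{l-\frac12}(-1)^{k+l-\frac12}\frac{l-k}{k!(2l-k)!}p_{2l-k}p_k-\frac{(l+\frac12)^2}{2}$. For an $\mathfrak{sl}_2$-module $N$, $N^{\tilde{\mathfrak g}}$ is $N$ with $\tilde{\mathcal H}^{(l)}$ acting by $0$. Tensor products carry the diagonal action $x(v\otimes w)=xv\otimes w+v\otimes xw$. *)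

theory Defs
  imports Complex_Main
begin

class cvec = ab_group_add +
  fixes cscale :: "complex \<Rightarrow> 'a \<Rightarrow> 'a" (infixr \<open>*c\<close> 75)
  assumes cscale_right_distrib: "a *c (x + y) = a *c x + a *c y"
    and cscale_left_distrib: "(a + b) *c x = a *c x + b *c x"
    and cscale_cscale: "a *c (b *c x) = (a * b) *c x"
    and cscale_one: "1 *c x = x"



definition csubspace :: "'v::cvec set \<Rightarrow> bool" where
  "csubspace V = module.subspace cscale V"

definition cspan :: "'v::cvec set \<Rightarrow> 'v set" where
  "cspan S = module.span cscale S"

definition lin_on :: "'v::cvec set \<Rightarrow> ('v \<Rightarrow> 'v) \<Rightarrow> bool" where
  "lin_on V f \<longleftrightarrow> f ` V \<subseteq> V \<and> (\<forall>u\<in>V. \<forall>w\<in>V. f (u + w) = f u + f w)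
      \<and> (\<forall>a. \<forall>u\<in>V. f (a *c u) = a *c f u)"

definition bilin_on :: "'m::cvec set \<Rightarrow> 'n::cvec set \<Rightarrow> ('m \<Rightarrow> 'n \<Rightarrow> 'w::cvec) \<Rightarrow> bool" where
  "bilin_on M N b \<longleftrightarrow>
     (\<forall>n\<in>N. \<forall>m1\<in>M. \<forall>m2\<in>M. b (m1 + m2) n = b m1 n + b m2 n) \<and>
     (\<forall>n\<in>N. \<forall>m\<in>M. \<forall>a. b (a *c m) n = a *c b m n) \<and>
     (\<forall>m\<in>M. \<forall>n1\<in>N. \<forall>n2\<in>N. b m (n1 + n2) = b m n1 + b m n2) \<and>
     (\<forall>m\<in>M. \<forall>n\<in>N. \<forall>a. b m (a *c n) = a *c b m n)"

definition bilin_form_on :: "'m::cvec set \<Rightarrow> 'n::cvec set \<Rightarrow> ('m \<Rightarrow> 'n \<Rightarrow> complex) \<Rightarrow> bool" where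
  "bilin_form_on M N B \<longleftrightarrow>
     (\<forall>n\<in>N. \<forall>m1\<in>M. \<forall>m2\<in>M. B (m1 + m2) n = B m1 n + B m2 n) \<and>
     (\<forall>n\<in>N. \<forall>m\<in>M. \<forall>a. B (a *c m) n = a * B m n) \<and>
     (\<forall>m\<in>M. \<forall>n1\<in>N. \<forall>n2\<in>N. B m (n1 + n2) = B m n1 + B m n2) \<and>
     (\<forall>m\<in>M. \<forall>n\<in>N. \<forall>a. B m (a *c n) = a * B m n)"

text \<open>(T, tp) is a tensor product of the vector spaces M and N: tp is bilinear,
  its image spans T, and every bilinear form on M x N factors (necessarily uniquely)
  through a linear functional on T.  For vector spaces over a field this characterises
  the tensor product M \<otimes> N up to unique isomorphism.\<close>
definition tensor_prod :: "'m::cvec set \<Rightarrow> 'n::cvec set \<Rightarrow> 't::cvec set \<Rightarrow> ('m \<Rightarrow> 'n \<Rightarrow> 't) \<Rightarrow> bool" where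
  "tensor_prod M N T tp \<longleftrightarrow>
     csubspace M \<and> csubspace N \<and> csubspace T \<and>
     (\<forall>m\<in>M. \<forall>n\<in>N. tp m n \<in> T) \<and> bilin_on M N tp \<and>
     T = cspan {tp m n | m n. m \<in> M \<and> n \<in> N} \<and>
     (\<forall>B. bilin_form_on M N B \<longrightarrow>
        (\<exists>L :: 't \<Rightarrow> complex. (\<forall>u\<in>T. \<forall>w\<in>T. L (u + w) = L u + L w) \<and>
             (\<forall>a. \<forall>u\<in>T. L (a *c u) = a * L u) \<and>
             (\<forall>m\<in>M. \<forall>n\<in>N. L (tp m n) = B m n)))"

text \<open>Basis elements: e, h, f, p_k, z.  Throughout, l = n + 1/2 with n :: nat,
  so 2l = 2n+1 and the p_k are indexed by k = 0..2n+1.  A representation of the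
  Lie algebra on a carrier V is given by the operators act x for basis elements x.\<close>
datatype gen = GE | GH | GF | GP nat | GZ

definition valid_gen :: "nat \<Rightarrow> gen \<Rightarrow> bool" where
  "valid_gen n x = (case x of GP k \<Rightarrow> k \<le> 2*n+1 | _ \<Rightarrow> True)"

definition heis_gens :: "nat \<Rightarrow> gen set" where
  "heis_gens n = {GZ} \<union> {GP k | k. k \<le> 2*n+1}"

definition sl2_gens :: "gen set" where
  "sl2_gens = {GE, GH, GF}"

definition all_gens :: "nat \<Rightarrow> gen set" where
  "all_gens n = sl2_gens \<union> heis_gens n"

abbreviation comm :: "('v::ab_group_add \<Rightarrow> 'v) \<Rightarrow> ('v \<Rightarrow> 'v) \<Rightarrow> 'v \<Rightarrow> 'v" where
  "comm f g v \<equiv> f (g v) - g (f v)"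

text \<open>Structure constant of [p_k, p_k'] (coefficient of z), 2l = 2n+1,
  (-1)^(k+l+1/2) = (-1)^(k+n+1).\<close>
definition pp_coeff :: "nat \<Rightarrow> nat \<Rightarrow> nat \<Rightarrow> complex" where
  "pp_coeff n k k' = (if k + k' = 2*n+1
      then (-1)^(k+n+1) * of_nat (fact k) * of_nat (fact (2*n+1-k)) else 0)"

definition heis_mod :: "nat \<Rightarrow> 'v::cvec set \<Rightarrow> (gen \<Rightarrow> 'v \<Rightarrow> 'v) \<Rightarrow> bool" where
  "heis_mod n V act \<longleftrightarrow> csubspace V \<and> (\<forall>x\<in>heis_gens n. lin_on V (act x)) \<and>
     (\<forall>v\<in>V. \<forall>k\<le>2*n+1. comm (act GZ) (act (GP k)) v = 0) \<and>
     (\<forall>v\<in>V. \<forall>k\<le>2*n+1. \<forall>k'\<le>2*n+1.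
        comm (act (GP k)) (act (GP k')) v = pp_coeff n k k' *c act GZ v)"

definition sl2_mod :: "'v::cvec set \<Rightarrow> (gen \<Rightarrow> 'v \<Rightarrow> 'v) \<Rightarrow> bool" where
  "sl2_mod V act \<longleftrightarrow> csubspace V \<and> (\<forall>x\<in>sl2_gens. lin_on V (act x)) \<and>
     (\<forall>v\<in>V. comm (act GH) (act GE) v = 2 *c act GE v) \<and>
     (\<forall>v\<in>V. comm (act GH) (act GF) v = (-2) *c act GF v) \<and>
     (\<forall>v\<in>V. comm (act GE) (act GF) v = act GH v)"

definition gt_mod :: "nat \<Rightarrow> 'v::cvec set \<Rightarrow> (gen \<Rightarrow> 'v \<Rightarrow> 'v) \<Rightarrow> bool" where
  "gt_mod n V act \<longleftrightarrow> sl2_mod V act \<and> heis_mod n V act \<and>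
     (\<forall>v\<in>V. \<forall>k\<le>2*n+1.
        comm (act GH) (act (GP k)) v = (2 * (of_nat n + 1/2 - of_nat k)) *c act (GP k) v) \<and>
     (\<forall>v\<in>V. \<forall>k\<le>2*n+1. comm (act GE) (act (GP k)) v = of_nat k *c act (GP (k - 1)) v) \<and>
     (\<forall>v\<in>V. \<forall>k\<le>2*n+1.
        comm (act GF) (act (GP k)) v = of_nat (2*n+1-k) *c act (GP (k + 1)) v) \<and>
     (\<forall>v\<in>V. \<forall>x\<in>sl2_gens. comm (act x) (act GZ) v = 0)"

definition simple_wrt :: "gen set \<Rightarrow> 'v::cvec set \<Rightarrow> (gen \<Rightarrow> 'v \<Rightarrow> 'v) \<Rightarrow> bool" where
  "simple_wrt G V act \<longleftrightarrow> V \<noteq> {0} \<and>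
     (\<forall>W. csubspace W \<longrightarrow> W \<subseteq> V \<longrightarrow> (\<forall>x\<in>G. act x ` W \<subseteq> W) \<longrightarrow> W = {0} \<or> W = V)"

definition simple_heis_mod :: "nat \<Rightarrow> 'v::cvec set \<Rightarrow> (gen \<Rightarrow> 'v \<Rightarrow> 'v) \<Rightarrow> bool" where
  "simple_heis_mod n V act \<longleftrightarrow> heis_mod n V act \<and> simple_wrt (heis_gens n) V act"

definition simple_sl2_mod :: "'v::cvec set \<Rightarrow> (gen \<Rightarrow> 'v \<Rightarrow> 'v) \<Rightarrow> bool" where
  "simple_sl2_mod V act \<longleftrightarrow> sl2_mod V act \<and> simple_wrt sl2_gens V act"

definition simple_gt_mod :: "nat \<Rightarrow> 'v::cvec set \<Rightarrow> (gen \<Rightarrow> 'v \<Rightarrow> 'v) \<Rightarrow> bool" where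
  "simple_gt_mod n V act \<longleftrightarrow> gt_mod n V act \<and> simple_wrt (all_gens n) V act"

text \<open>For an H~-module with action act on which z acts as the nonzero scalar c,
  the g~-action on M^g~ obtained via Phi_l (1/z acts as 1/c).  Here l = n + 1/2,
  2l = 2n+1, l - k = n + 1/2 - k, (-1)^(k+l+1/2) = (-1)^(k+n+1),
  (-1)^(k+l-1/2) = (-1)^(k+n), l - 1/2 = n, (l+1/2)^2/2 = (n+1)^2/2.\<close>
definition phi_act :: "nat \<Rightarrow> complex \<Rightarrow> (gen \<Rightarrow> 'v::cvec \<Rightarrow> 'v) \<Rightarrow> gen \<Rightarrow> 'v \<Rightarrow> 'v" where
  "phi_act n c act x v = (case x of
      GE \<Rightarrow> (1 / c) *c (\<Sum>k\<in>{1..2*n+1}.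
              ((-1)^(k+n+1) * (of_nat n + 1/2 - of_nat k)
                 / (of_nat (fact (k - 1)) * of_nat (fact (2*n+1-k))))
              *c act (GP (k - 1)) (act (GP (2*n+1-k)) v))
    | GF \<Rightarrow> (1 / c) *c (\<Sum>k\<in>{1..2*n+1}.
              ((-1)^(k+n) * (of_nat n + 1/2 - of_nat k)
                 / (of_nat (fact (k - 1)) * of_nat (fact (2*n+1-k))))
              *c act (GP k) (act (GP (2*n+2-k)) v))
    | GH \<Rightarrow> (2 / c) *c (\<Sum>k\<in>{0..n}.
              ((-1)^(k+n) * (of_nat n + 1/2 - of_nat k)
                 / (of_nat (fact k) * of_nat (fact (2*n+1-k))))
              *c act (GP (2*n+1-k)) (act (GP k) v))
            - ((of_nat n + 1)^2 / 2) *c v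
    | GP k \<Rightarrow> act (GP k) v
    | GZ \<Rightarrow> act GZ v)"

definition triv_act :: "(gen \<Rightarrow> 'v::cvec \<Rightarrow> 'v) \<Rightarrow> gen \<Rightarrow> 'v \<Rightarrow> 'v" where
  "triv_act act x v = (case x of GP k \<Rightarrow> 0 | GZ \<Rightarrow> 0 | _ \<Rightarrow> act x v)"

end

(*
  A simple module M over the Heisenberg algebra with nonzero central character has countable
  dimension, so by Dixmier's version of Schur's lemma its only endomorphisms are scalars, and by
  Jacobson density any finite independent family in M can be moved to arbitrary targets.

  (i) A nonzero g-stable W in the tensor product contains some element sum_b b (x) v_b with
  independent b's and a nonzero v_0; density turns it into M (x) v_0.  The set of all v with
  M (x) v inside W is then a nonzero sl2-submodule of N, hence all of N.

  (ii) On V the operators sigma x = x - phi x (x in sl2) commute with the Heisenberg algebra and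
  again satisfy the sl2 relations.  They act on the multiplicity space N = Hom(M, V), and
  evaluation M (x) N -> V is injective by density and surjective because V is simple.
*)
theory Submission
  imports Defs "HOL-Computational_Algebra.Fundamental_Theorem_Algebra"
    "HOL-Analysis.Continuum_Not_Denumerable"
begin

section \<open>Linear algebra and operator polynomials\<close>

text \<open>\<open>M\<close> is never finite-dimensional: p_0 and p_{2l} have a nonzero scalar as
  commutator, while commutators of matrices have trace zero. Endomorphisms therefore have no
  eigenvalue for an elementary reason, and the uncountability of the complex numbers replaces the
  characteristic polynomial.

  Phi is the oscillator realisation: sl2 acts on the span of the p_k by infinitesimal symplectic
  maps, and quadratic expressions in the p_k implement these maps as commutators. Hence x and phi x
  have the same brackets with every p_k, which makes sigma x commute with the Heisenberg algebra,
  and so with every phi y. The constant (l+1/2)^2/2 is forced by [e, f] = h: it is the scalar left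
  when the quadratic terms of [e, f] are reordered.

  In (ii) \<open>N\<close> has to live in the type of \<open>V\<close>, whereas homomorphisms are
  functions; they are therefore replaced by their values at one fixed vector.\<close>

interpretation cv: vector_space "cscale :: complex \<Rightarrow> 'a::cvec \<Rightarrow> 'a"
  rewrites "module.subspace (cscale :: complex \<Rightarrow> 'a \<Rightarrow> 'a) = csubspace"
    and "module.span (cscale :: complex \<Rightarrow> 'a \<Rightarrow> 'a) = cspan"
proof -
  show "vector_space (cscale :: complex \<Rightarrow> 'a \<Rightarrow> 'a)"
    by unfold_locales (simp_all add: cscale_right_distrib cscale_left_distrib cscale_cscale cscale_one)
qed (simp_all add: fun_eq_iff csubspace_def cspan_def)

lemma lin_onI:
  assumes "\<And>v. v \<in> V \<Longrightarrow> f v \<in> V"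
    and "\<And>u w. u \<in> V \<Longrightarrow> w \<in> V \<Longrightarrow> f (u + w) = f u + f w"
    and "\<And>a u. u \<in> V \<Longrightarrow> f (a *c u) = a *c f u"
  shows "lin_on V f"
  using assms unfolding lin_on_def by blast

lemma lin_on_in: "lin_on V f \<Longrightarrow> v \<in> V \<Longrightarrow> f v \<in> V"
  unfolding lin_on_def by blast

lemma lin_on_add: "lin_on V f \<Longrightarrow> u \<in> V \<Longrightarrow> w \<in> V \<Longrightarrow> f (u + w) = f u + f w"
  unfolding lin_on_def by blast

lemma lin_on_scale: "lin_on V f \<Longrightarrow> u \<in> V \<Longrightarrow> f (a *c u) = a *c f u"
  unfolding lin_on_def by blast

lemma lin_on_zero:
  assumes "lin_on V f" "csubspace V"
  shows "f 0 = 0"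
  using lin_on_scale[OF assms(1) cv.subspace_0[OF assms(2)], of 0] by simp

lemma lin_on_minus: "lin_on V f \<Longrightarrow> u \<in> V \<Longrightarrow> f (- u) = - f u"
  using lin_on_scale[of V f u "-1"] by simp

lemma lin_on_diff: "lin_on V f \<Longrightarrow> csubspace V \<Longrightarrow> u \<in> V \<Longrightarrow> w \<in> V \<Longrightarrow> f (u - w) = f u - f w"
  using lin_on_add[of V f u "-w"] lin_on_minus[of V f w] cv.subspace_neg[of V w] by simp

lemma lin_on_sum:
  assumes "lin_on V f" "csubspace V" "\<And>i. i \<in> I \<Longrightarrow> g i \<in> V"
  shows "f (\<Sum>i\<in>I. g i) = (\<Sum>i\<in>I. f (g i))"
  using assms(3)
proof (induction I rule: infinite_finite_induct)
  case (insert x F)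
  then show ?case
    by (simp add: lin_on_add[OF assms(1)] cv.subspace_sum[OF assms(2)])
qed (simp_all add: lin_on_zero[OF assms(1,2)])

lemma csubspace_kernel:
  assumes "lin_on V f" "csubspace V"
  shows "csubspace {v \<in> V. f v = 0}"
  by (rule cv.subspaceI)
    (auto simp: cv.subspace_0 cv.subspace_add cv.subspace_scale assms(2) lin_on_zero[OF assms]
      lin_on_add[OF assms(1)] lin_on_scale[OF assms(1)])

lemma csubspace_image:
  assumes "lin_on V f" "csubspace V"
  shows "csubspace (f ` V)"
proof (rule cv.subspaceI)
  show "0 \<in> f ` V" using lin_on_zero[OF assms] cv.subspace_0[OF assms(2)] by (metis imageI)
next
  fix x y assume "x \<in> f ` V" "y \<in> f ` V"
  then obtain u v where "u \<in> V" "v \<in> V" "x = f u" "y = f v" by blast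
  then show "x + y \<in> f ` V"
    using lin_on_add[OF assms(1), of u v] cv.subspace_add[OF assms(2), of u v] by (metis imageI)
next
  fix a x assume "x \<in> f ` V"
  then obtain u where "u \<in> V" "x = f u" by blast
  then show "a *c x \<in> f ` V"
    using lin_on_scale[OF assms(1), of u a] cv.subspace_scale[OF assms(2), of u a] by (metis imageI)
qed

lemma cspan_induct_lin:
  assumes "v \<in> cspan B" "csubspace V" "B \<subseteq> V" "lin_on V f" "lin_on V g"
    and "\<And>b. b \<in> B \<Longrightarrow> f b = g b"
  shows "f v = g v"
proof -
  have "csubspace {v \<in> V. f v = g v}"
    by (rule cv.subspaceI)
      (auto simp: cv.subspace_0 cv.subspace_add cv.subspace_scale assms(2) lin_on_zero[OF assms(4,2)]
        lin_on_zero[OF assms(5,2)] lin_on_add[OF assms(4)] lin_on_add[OF assms(5)]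
        lin_on_scale[OF assms(4)] lin_on_scale[OF assms(5)])
  moreover have "B \<subseteq> {v \<in> V. f v = g v}" using assms by auto
  ultimately have "cspan B \<subseteq> {v \<in> V. f v = g v}" by (intro cv.span_minimal)
  with assms(1) show ?thesis by auto
qed

text \<open>Every element of \<open>I\<close> lies in the span of a finite subset of
  \<open>C\<close>. There are countably many such subsets, and each of their spans holds only
  finitely many independent vectors.\<close>

lemma countable_independent:
  assumes "countable C" "cv.independent I" "I \<subseteq> cspan C"
  shows "countable I"
proof -
  have "I \<subseteq> (\<Union>T\<in>{T. finite T \<and> T \<subseteq> C}. I \<inter> cspan T)"
  proof
    fix x assume "x \<in> I"
    with assms(3) have "x \<in> cspan C" by blast
    then obtain T r where "finite T" "T \<subseteq> C" "x = (\<Sum>a\<in>T. r a *c a)"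
      unfolding cv.span_explicit by blast
    moreover from this have "x \<in> cspan T"
      by (simp add: cv.span_sum cv.span_scale cv.span_base)
    ultimately show "x \<in> (\<Union>T\<in>{T. finite T \<and> T \<subseteq> C}. I \<inter> cspan T)" using \<open>x \<in> I\<close> by blast
  qed
  moreover have "countable (\<Union>T\<in>{T. finite T \<and> T \<subseteq> C}. I \<inter> cspan T)"
  proof (rule countable_UN)
    show "countable {T. finite T \<and> T \<subseteq> C}"
      using countable_Collect_finite_subset[OF assms(1)] by (simp add: conj_commute)
    fix T assume "T \<in> {T. finite T \<and> T \<subseteq> C}"
    then have "finite (I \<inter> cspan T)"
      using cv.independent_span_bound[of T "I \<inter> cspan T"] cv.independent_mono[OF assms(2), of "I \<inter> cspan T"]
      by auto
    then show "countable (I \<inter> cspan T)" by (rule countable_finite)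
  qed
  ultimately show ?thesis by (rule countable_subset)
qed

section \<open>Polynomials in one operator and its resolvents\<close>

definition poly_op :: "('v::cvec \<Rightarrow> 'v) \<Rightarrow> complex poly \<Rightarrow> 'v \<Rightarrow> 'v" where
  "poly_op \<theta> p v = fold_coeffs (\<lambda>a y. a *c v + \<theta> y) p 0"

context
  fixes V :: "'v::cvec set" and \<theta> :: "'v \<Rightarrow> 'v"
  assumes V: "csubspace V" and lin: "lin_on V \<theta>"
begin

lemma poly_op_0 [simp]: "poly_op \<theta> 0 v = 0"
  by (simp add: poly_op_def)

lemma poly_op_pCons [simp]: "poly_op \<theta> (pCons a p) v = a *c v + \<theta> (poly_op \<theta> p v)"
  \<comment> \<open>\<open>pCons 0 0\<close> is the zero polynomial, on which the fold takes no
    step; there the equation reduces to \<theta> 0 = 0.\<close>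
  by (cases "p = 0 \<and> a = 0") (auto simp: poly_op_def lin_on_zero[OF lin V])

lemma poly_op_in: "v \<in> V \<Longrightarrow> poly_op \<theta> p v \<in> V"
  by (induction p) (auto intro!: cv.subspace_add[OF V] cv.subspace_scale[OF V] lin_on_in[OF lin]
      simp: cv.subspace_0[OF V])

lemma poly_op_add: "v \<in> V \<Longrightarrow> poly_op \<theta> (p + q) v = poly_op \<theta> p v + poly_op \<theta> q v"
  by (induction p q rule: poly_induct2)
    (simp_all add: lin_on_add[OF lin] poly_op_in cscale_left_distrib)

lemma poly_op_smult: "v \<in> V \<Longrightarrow> poly_op \<theta> (smult c p) v = c *c poly_op \<theta> p v"
  by (induction p)
    (simp_all add: lin_on_scale[OF lin] poly_op_in cscale_right_distrib cscale_cscale)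

lemma poly_op_sum:
  assumes "v \<in> V"
  shows "poly_op \<theta> (\<Sum>i\<in>I. p i) v = (\<Sum>i\<in>I. poly_op \<theta> (p i) v)"
  by (induction I rule: infinite_finite_induct) (simp_all add: poly_op_add assms)

lemma poly_op_linear_factor:
  assumes "v \<in> V"
  shows "poly_op \<theta> ([:-\<mu>, 1:] * p) v = \<theta> (poly_op \<theta> p v) - \<mu> *c poly_op \<theta> p v"
  by (simp add: poly_op_add poly_op_smult assms del: smult_minus_left)

lemma poly_op_lin: "lin_on V (poly_op \<theta> p)"
proof (induction p)
  case 0
  then show ?case by (auto intro!: lin_onI simp: cv.subspace_0[OF V])
next
  case (pCons a p)
  show ?case
    by (rule lin_onI)
      (simp_all add: poly_op_in cv.subspace_add[OF V] cv.subspace_scale[OF V] lin_on_in[OF lin]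
        lin_on_add[OF lin] lin_on_add[OF pCons(2)] lin_on_scale[OF lin] lin_on_scale[OF pCons(2)]
        cscale_right_distrib cscale_cscale mult.commute)
qed

lemma poly_op_commute: "v \<in> V \<Longrightarrow> poly_op \<theta> p (\<theta> v) = \<theta> (poly_op \<theta> p v)"
  by (induction p)
    (simp_all add: lin_on_zero[OF lin V] poly_op_in lin_on_in[OF lin] lin_on_add[OF lin] 
     lin_on_scale[OF lin] cv.subspace_scale[OF V])

text \<open>With the linear factor applied first, an equation (\<theta> - \<nu>) r = w turns
  P(\<theta>) r into Q(\<theta>) w, where P = (X - \<nu>) Q.\<close>

lemma poly_op_linear_factor':
  assumes "v \<in> V"
  shows "poly_op \<theta> ([:-\<mu>, 1:] * p) v = poly_op \<theta> p (\<theta> v - \<mu> *c v)"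
  using lin_on_diff[OF poly_op_lin V, of "\<theta> v" "\<mu> *c v" p] assms
  by (simp add: poly_op_linear_factor poly_op_commute lin_on_in[OF lin] cv.subspace_scale[OF V]
      lin_on_scale[OF poly_op_lin] del: mult_pCons_left)

text \<open>Over the complex numbers \<open>p\<close> splits into linear factors, and by
  \<open>inj\<close> each \<theta> - \<mu> is injective on \<open>V\<close>.\<close>

lemma poly_op_nonzero:
  assumes inj: "\<forall>\<mu>. \<forall>v\<in>V. \<theta> v = \<mu> *c v \<longrightarrow> v = 0"
    and v: "v \<in> V" "v \<noteq> 0"
  shows "p \<noteq> 0 \<Longrightarrow> poly_op \<theta> p v \<noteq> 0"
proof (induction "degree p" arbitrary: p)
  case 0
  then obtain a where "p = [:a:]" "a \<noteq> 0" by (metis degree_eq_zeroE pCons_0_0)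
  then show ?case using v by (simp add: lin_on_zero[OF lin V])
next
  case (Suc d)
  then obtain \<mu> where "poly p \<mu> = 0" using alg_closed_imp_poly_has_root[of p] by auto
  then obtain q where q: "p = [:-\<mu>, 1:] * q" by (auto simp: poly_eq_0_iff_dvd)
  with Suc.prems have "q \<noteq> 0" by auto
  then have "degree p = Suc (degree q)" unfolding q by (subst degree_mult_eq) auto
  with Suc.hyps have "poly_op \<theta> q v \<noteq> 0" using \<open>q \<noteq> 0\<close> by auto
  then show ?case
    unfolding q poly_op_linear_factor[OF v(1)] using inj poly_op_in[OF v(1), of q] \<open>poly_op \<theta> q v \<noteq> 0\<close> by auto
qed

text \<open>Apply the product of all \<open>\<theta> - \<nu>\<close> to a relation between the resolvent vectors.\<close>
lemma resolvent_independent: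
  assumes inj: "\<forall>\<mu>. \<forall>v\<in>V. \<theta> v = \<mu> *c v \<longrightarrow> v = 0"
    and w: "w \<in> V" "w \<noteq> 0"
    and r: "\<And>\<nu>. r \<nu> \<in> V" "\<And>\<nu>. \<theta> (r \<nu>) - \<nu> *c r \<nu> = w"
    and F: "finite F" and rel: "(\<Sum>\<nu>\<in>F. a \<nu> *c r \<nu>) = 0" and "\<nu>0 \<in> F"
  shows "a \<nu>0 = 0"
proof -
  define P where "P = (\<Prod>\<mu>\<in>F. [:-\<mu>, 1:])"
  define Q where "Q = (\<lambda>\<nu>. \<Prod>\<mu>\<in>F - {\<nu>}. [:-\<mu>, 1:])"
  have P: "P = [:-\<nu>, 1:] * Q \<nu>" if "\<nu> \<in> F" for \<nu>
    unfolding P_def Q_def using prod.remove[OF F that] by blast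
  \<comment> \<open>Since P(\<theta>) sends \<open>r \<nu>\<close> to Q_\<nu>(\<theta>) w, the
    vector p(\<theta>) w is P(\<theta>) applied to the given relation.\<close>
  define p where "p = (\<Sum>\<nu>\<in>F. smult (a \<nu>) (Q \<nu>))"
  have "poly_op \<theta> p w = (\<Sum>\<nu>\<in>F. a \<nu> *c poly_op \<theta> (Q \<nu>) w)"
    by (simp add: p_def poly_op_sum poly_op_smult w)
  also have "\<dots> = (\<Sum>\<nu>\<in>F. poly_op \<theta> P (a \<nu> *c r \<nu>))"
  proof (rule sum.cong)
    fix \<nu> assume "\<nu> \<in> F"
    have "poly_op \<theta> P (r \<nu>) = poly_op \<theta> (Q \<nu>) w"
      unfolding P[OF \<open>\<nu> \<in> F\<close>] using poly_op_linear_factor'[OF r(1)] r(2) by metis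
    then show "a \<nu> *c poly_op \<theta> (Q \<nu>) w = poly_op \<theta> P (a \<nu> *c r \<nu>)"
      by (simp add: lin_on_scale[OF poly_op_lin] r)
  qed simp
  also have "\<dots> = poly_op \<theta> P (\<Sum>\<nu>\<in>F. a \<nu> *c r \<nu>)"
    by (rule lin_on_sum[OF poly_op_lin V, symmetric]) (simp add: cv.subspace_scale[OF V] r)
  also have "\<dots> = 0" unfolding rel by (rule lin_on_zero[OF poly_op_lin V])
  finally have "p = 0" using poly_op_nonzero[OF inj w] by blast
  \<comment> \<open>\<open>Q \<nu>\<close> vanishes at \<open>\<nu>0\<close> for every other \<nu>
    in \<open>F\<close>, so evaluation isolates \<open>a \<nu>0\<close>, as in Lagrange
    interpolation.\<close>
  then have "0 = poly p \<nu>0" by simp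
  also have "\<dots> = (\<Sum>\<nu>\<in>F. a \<nu> * poly (Q \<nu>) \<nu>0)" by (simp add: p_def poly_sum)
  also have "\<dots> = a \<nu>0 * poly (Q \<nu>0) \<nu>0 + (\<Sum>\<nu>\<in>F - {\<nu>0}. a \<nu> * poly (Q \<nu>) \<nu>0)"
    by (rule sum.remove[OF F \<open>\<nu>0 \<in> F\<close>])
  also have "(\<Sum>\<nu>\<in>F - {\<nu>0}. a \<nu> * poly (Q \<nu>) \<nu>0) = 0"
    by (rule sum.neutral) (use F \<open>\<nu>0 \<in> F\<close> in \<open>auto simp: Q_def poly_prod\<close>)
  finally have "a \<nu>0 * poly (Q \<nu>0) \<nu>0 = 0" by simp
  moreover have "poly (Q \<nu>0) \<nu>0 \<noteq> 0" using F by (simp add: Q_def poly_prod)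
  ultimately show ?thesis by simp
qed

end

section \<open>Schur's lemma and Jacobson density\<close>

text \<open>The image of the enveloping algebra, as functions on the whole type: membership does not
  refer to a carrier, so one element can be applied in a submodule and in the module around it.
  Products grow by one generator on the left, which keeps inductions to a single generator.\<close>

inductive_set opalg :: "('v::cvec \<Rightarrow> 'v) set \<Rightarrow> ('v \<Rightarrow> 'v) set" for S where
  opalg_id: "(\<lambda>v. v) \<in> opalg S"
| opalg_step: "s \<in> S \<Longrightarrow> a \<in> opalg S \<Longrightarrow> (\<lambda>v. s (a v)) \<in> opalg S"
| opalg_add: "a \<in> opalg S \<Longrightarrow> b \<in> opalg S \<Longrightarrow> (\<lambda>v. a v + b v) \<in> opalg S"
| opalg_scale: "a \<in> opalg S \<Longrightarrow> (\<lambda>v. c *c a v) \<in> opalg S"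

lemma opalg_gen: "s \<in> S \<Longrightarrow> s \<in> opalg S"
  using opalg_step[OF _ opalg_id, of s S] by simp

lemma opalg_zero: "(\<lambda>v. 0) \<in> opalg S"
  using opalg_scale[OF opalg_id, of 0 S] by simp

lemma opalg_diff: "a \<in> opalg S \<Longrightarrow> b \<in> opalg S \<Longrightarrow> (\<lambda>v. a v - b v) \<in> opalg S"
  using opalg_add[OF _ opalg_scale[of b S "-1"], of a] by simp

lemma opalg_sum: "(\<And>i. i \<in> I \<Longrightarrow> a i \<in> opalg S) \<Longrightarrow> (\<lambda>v. \<Sum>i\<in>I. a i v) \<in> opalg S"
  by (induction I rule: infinite_finite_induct) (simp_all add: opalg_zero opalg_add)

lemma opalg_stable:
  assumes "csubspace W" "\<And>s. s \<in> S \<Longrightarrow> s ` W \<subseteq> W" "a \<in> opalg S" "v \<in> W"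
  shows "a v \<in> W"
  using assms(3,4)
  by (induction a) (use assms(1,2) in \<open>auto intro: cv.subspace_add cv.subspace_scale\<close>)

lemma opalg_lin:
  assumes V: "csubspace V" and S: "\<forall>s\<in>S. lin_on V s" and "a \<in> opalg S"
  shows "lin_on V a"
  using assms(3)
proof (induction a)
  case opalg_id
  show ?case by (rule lin_onI) auto
next
  case (opalg_step s a)
  then show ?case
    using lin_on_in[of V a] lin_on_add[of V a] lin_on_scale[of V a]
    by (intro lin_onI) (auto simp: lin_on_in[OF S[rule_format]] lin_on_add[OF S[rule_format]]
        lin_on_scale[OF S[rule_format]])
next
  case (opalg_add a b)
  then show ?case
    by (intro lin_onI) (simp_all add: lin_on_in lin_on_add lin_on_scale cv.subspace_add[OF V] cscale_right_distrib)
next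
  case (opalg_scale a c)
  then show ?case
    by (intro lin_onI) (simp_all add: lin_on_in lin_on_add lin_on_scale cv.subspace_scale[OF V]
        cscale_right_distrib cscale_cscale mult.commute)
qed

lemma opalg_comp:
  assumes V: "csubspace V" and S: "\<forall>s\<in>S. lin_on V s"
    and "a \<in> opalg S" and b: "b \<in> opalg S"
  shows "(\<lambda>v. a (b v)) \<in> opalg S"
  using assms(3)
proof (induction a)
  case (opalg_step s a)
  show ?case by (rule opalg.opalg_step[OF opalg_step(1,3)])
qed (use b in \<open>simp_all add: opalg.opalg_add opalg.opalg_scale\<close>)

lemma opalg_commute:
  assumes V: "csubspace V" and S: "\<forall>s\<in>S. lin_on V s" and \<theta>: "lin_on V \<theta>"
    and c: "\<forall>s\<in>S. \<forall>v\<in>V. \<theta> (s v) = s (\<theta> v)"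
    and "a \<in> opalg S" "v \<in> V"
  shows "\<theta> (a v) = a (\<theta> v)"
  using assms(5)
  by (induction a)
    (simp_all add: c lin_on_in[OF opalg_lin[OF V S]] \<open>v \<in> V\<close> lin_on_add[OF \<theta>] lin_on_scale[OF \<theta>])

text \<open>Schur's lemma and density are proved for any countable set of operators acting simply;
  countability is what bounds the dimension.\<close>

locale simple_ops =
  fixes S :: "('v::cvec \<Rightarrow> 'v) set" and M
  assumes sub: "csubspace M" and lin: "\<And>s. s \<in> S \<Longrightarrow> lin_on M s"
    and nonzero: "M \<noteq> {0}" and countable: "countable S"
    and simple: "\<And>W. csubspace W \<Longrightarrow> W \<subseteq> M \<Longrightarrow> (\<And>s. s \<in> S \<Longrightarrow> s ` W \<subseteq> W) \<Longrightarrow> W = {0} \<or> W = M"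
begin

lemma gen_lin: "\<forall>s\<in>S. lin_on M s"
  using lin by blast

lemmas alg_lin = opalg_lin[OF sub gen_lin]

lemma alg_in: "a \<in> opalg S \<Longrightarrow> v \<in> M \<Longrightarrow> a v \<in> M"
  by (rule lin_on_in[OF alg_lin])

text \<open>Words in the generators applied to one nonzero vector \<open>m\<close> span a stable
  subspace, which is therefore \<open>M\<close>; a countable alphabet has countably many
  words.\<close>

lemma countable_span: "\<exists>C. countable C \<and> M \<subseteq> cspan C"
proof -
  obtain m where m: "m \<in> M" "m \<noteq> 0" using nonzero cv.subspace_0[OF sub] by blast
  define C where "C = (\<lambda>xs. foldr (\<lambda>s v. s v) xs m) ` lists S"
  have CM: "foldr (\<lambda>s v. s v) xs m \<in> M" if "xs \<in> lists S" for xs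
    using that by (induction xs) (auto simp: m lin_on_in[OF lin])
  then have CM': "C \<subseteq> M" by (auto simp: C_def)
  have spM: "cspan C \<subseteq> M" using cv.span_minimal[OF CM' sub] .
  have "s ` cspan C \<subseteq> cspan C" if s: "s \<in> S" for s
  proof (clarify)
    fix v assume "v \<in> cspan C"
    \<comment> \<open>Membership in \<open>M\<close> is carried along because \<open>s\<close> is
      linear only there.\<close>
    then have "v \<in> M \<and> s v \<in> cspan C"
    proof (induction v rule: cv.span_induct_alt)
      case base
      then show ?case by (simp add: cv.subspace_0[OF sub] lin_on_zero[OF lin[OF s] sub] cv.span_zero)
    next
      case (step c x y)
      then obtain xs where xs: "xs \<in> lists S" "x = foldr (\<lambda>s v. s v) xs m" by (auto simp: C_def)
      then have "s x = foldr (\<lambda>s v. s v) (s # xs) m" by simp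
      then have "s x \<in> C" unfolding C_def by (rule image_eqI) (use s xs(1) in simp)
      moreover have "x \<in> M" using step CM' by blast
      ultimately show ?case using step
        by (simp add: cv.subspace_add[OF sub] cv.subspace_scale[OF sub] lin_on_add[OF lin[OF s]]
            lin_on_scale[OF lin[OF s]] cv.span_add cv.span_scale cv.span_base)
    qed
    then show "s v \<in> cspan C" ..
  qed
  then have "cspan C = {0} \<or> cspan C = M" by (intro simple spM) auto
  moreover have "m \<in> C" unfolding C_def by (rule image_eqI[of _ _ "[]"]) auto
  ultimately have "cspan C = M" using m cv.span_base[of m C] by auto
  moreover have "countable C" unfolding C_def using countable by (intro countable_image countable_lists)
  ultimately show ?thesis by blast
qed

text \<open>Dixmier's form of Schur's lemma: a non-scalar endomorphism has an uncountable independent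
  family of resolvent vectors.\<close>
lemma schur:
  assumes \<theta>: "lin_on M \<theta>" and comm: "\<forall>s\<in>S. \<forall>v\<in>M. \<theta> (s v) = s (\<theta> v)"
  shows "\<exists>\<nu>. \<forall>v\<in>M. \<theta> v = \<nu> *c v"
proof (rule ccontr)
  assume non: "\<not> ?thesis"
  have T: "lin_on M (\<lambda>v. \<theta> v - \<nu> *c v)" for \<nu>
    by (rule lin_onI) (simp_all add: lin_on_in[OF \<theta>] lin_on_add[OF \<theta>] lin_on_scale[OF \<theta>]
        cv.subspace_diff[OF sub] cv.subspace_scale[OF sub] cscale_right_distrib
        cv.scale_right_diff_distrib mult.commute)
  have Tc: "\<theta> (s v) - \<nu> *c s v = s (\<theta> v - \<nu> *c v)" if "s \<in> S" "v \<in> M" for s v \<nu>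
    using that by (simp add: comm lin_on_diff[OF lin sub] lin_on_in[OF \<theta>] cv.subspace_scale[OF sub]
        lin_on_scale[OF lin])
  \<comment> \<open>Kernel and image of \<theta> - \<nu> are stable. As \<theta> is not the scalar
    \<nu>, simplicity makes the kernel zero and, below, the image all of \<open>M\<close>.\<close>
  have ker: "{v \<in> M. \<theta> v - \<nu> *c v = 0} = {0}" for \<nu>
  proof -
    let ?K = "{v \<in> M. \<theta> v - \<nu> *c v = 0}"
    have "?K = {0} \<or> ?K = M"
    proof (rule simple)
      show "csubspace ?K" by (rule csubspace_kernel[OF T sub])
      show "s ` ?K \<subseteq> ?K" if "s \<in> S" for s
      proof clarify
        fix v assume v: "v \<in> M" "\<theta> v - \<nu> *c v = 0"
        then have "\<theta> (s v) - \<nu> *c s v = 0"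
          using Tc[OF that v(1), of \<nu>] lin_on_zero[OF lin[OF that] sub] by (simp only:)
        then show "s v \<in> M \<and> \<theta> (s v) - \<nu> *c s v = 0" using lin_on_in[OF lin[OF that]] v by blast
      qed
    qed auto
    moreover have "?K \<noteq> M" using non by auto
    ultimately show ?thesis by blast
  qed
  have im: "(\<lambda>v. \<theta> v - \<nu> *c v) ` M = M" for \<nu>
  proof -
    let ?I = "(\<lambda>v. \<theta> v - \<nu> *c v) ` M"
    have "?I = {0} \<or> ?I = M"
    proof (rule simple)
      show "csubspace ?I" by (rule csubspace_image[OF T sub])
      show "?I \<subseteq> M" using lin_on_in[OF T] by blast
      show "s ` ?I \<subseteq> ?I" if "s \<in> S" for s
      proof clarify
        fix v assume v: "v \<in> M"
        show "s (\<theta> v - \<nu> *c v) \<in> ?I"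
          using Tc[OF that v, of \<nu>, symmetric] lin_on_in[OF lin[OF that] v] by (rule image_eqI)
      qed
    qed
    moreover have "?I \<noteq> {0}"
    proof
      assume "?I = {0}"
      then have "\<forall>v\<in>M. \<theta> v - \<nu> *c v = 0" by (metis (no_types, lifting) imageI singletonD)
      then have "M \<subseteq> {v \<in> M. \<theta> v - \<nu> *c v = 0}" by blast
      then show False using ker[of \<nu>] nonzero cv.subspace_0[OF sub] by auto
    qed
    ultimately show ?thesis by blast
  qed
  obtain w where w: "w \<in> M" "w \<noteq> 0" using nonzero cv.subspace_0[OF sub] by blast
  \<comment> \<open>For fixed \<open>w\<close>, each \<nu> gives a vector \<open>r \<nu>\<close>,
    the value at \<open>w\<close> of the inverse of \<theta> - \<nu>.\<close>
  have "\<forall>\<nu>. \<exists>v\<in>M. \<theta> v - \<nu> *c v = w" using im w(1) by (metis (no_types, lifting) image_iff)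
  then obtain r where r: "\<And>\<nu>. r \<nu> \<in> M" "\<And>\<nu>. \<theta> (r \<nu>) - \<nu> *c r \<nu> = w" by metis
  have inj: "\<forall>\<mu>. \<forall>v\<in>M. \<theta> v = \<mu> *c v \<longrightarrow> v = 0"
    using ker by auto
  have injr: "inj r"
  proof (rule injI)
    fix x y assume e: "r x = r y"
    have "x *c r x = y *c r x" using r(2)[of x] r(2)[of y] e by (metis diff_left_imp_eq)
    moreover have "r x \<noteq> 0" using r(2)[of x] w(2) lin_on_zero[OF \<theta> sub] by auto
    ultimately show "x = y" by simp
  qed
  have "cv.independent (range r)"
    unfolding cv.independent_explicit_module
  proof (intro allI impI)
    fix t u v assume t: "finite t" "t \<subseteq> range r" "(\<Sum>v\<in>t. u v *c v) = 0" "v \<in> t"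
    define F where "F = r -` t"
    have tF: "t = r ` F" using t(2) by (auto simp: F_def)
    have F: "finite F" unfolding F_def using t(1) injr by (rule finite_vimageI)
    have rel: "(\<Sum>\<nu>\<in>F. u (r \<nu>) *c r \<nu>) = 0"
      using t(3) unfolding tF by (subst (asm) sum.reindex) (use injr in \<open>auto intro: inj_on_subset\<close>)
    obtain \<nu>0 where "\<nu>0 \<in> F" "v = r \<nu>0" using t(4) tF by blast
    then show "u v = 0"
      using resolvent_independent[OF sub \<theta> inj w r F rel] by blast
  qed
  moreover obtain C where "countable C" "M \<subseteq> cspan C" using countable_span by blast
  moreover have "range r \<subseteq> cspan C" using r(1) \<open>M \<subseteq> cspan C\<close> by blast
  ultimately have "countable (range r)" by (metis countable_independent)
  then have "countable (UNIV :: complex set)" using injr by (rule countable_image_inj_on)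
  then have "countable (range complex_of_real)" by (rule countable_subset[rotated]) simp
  then have "countable (UNIV :: real set)" by (rule countable_image_inj_on) (simp add: inj_def)
  then show False using uncountable_UNIV_real by blast
qed

section \<open>Annihilators and density\<close>

definition ann :: "'v set \<Rightarrow> ('v \<Rightarrow> 'v) set" where
  "ann F = {a \<in> opalg S. \<forall>y\<in>F. a y = 0}"

lemma ann_add: "a \<in> ann F \<Longrightarrow> b \<in> ann F \<Longrightarrow> (\<lambda>v. a v + b v) \<in> ann F"
  by (simp add: ann_def opalg_add)

lemma ann_scale: "a \<in> ann F \<Longrightarrow> (\<lambda>v. c *c a v) \<in> ann F"
  by (simp add: ann_def opalg_scale)

lemma ann_step:
  assumes "s \<in> S" "a \<in> ann F"
  shows "(\<lambda>v. s (a v)) \<in> ann F"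
  using assms opalg_step[of s S a] by (simp add: ann_def lin_on_zero[OF lin sub])

lemma ann_alg: "a \<in> ann F \<Longrightarrow> a \<in> opalg S"
  by (simp add: ann_def)

text \<open>\<open>ann F\<close> is a left ideal, so its values at \<open>y\<close> form a stable
  subspace, which is all of \<open>M\<close> once it is nonzero. For empty \<open>F\<close> this
  says that a nonzero vector generates \<open>M\<close>.\<close>

lemma ann_cyclic:
  assumes a: "a \<in> ann F" "y \<in> M" "a y \<noteq> 0" and m: "m \<in> M"
  shows "\<exists>b\<in>ann F. b y = m"
proof -
  let ?W = "(\<lambda>b. b y) ` ann F"
  have "?W = {0} \<or> ?W = M"
  proof (rule simple)
    show "csubspace ?W"
    proof (rule cv.subspaceI)
      show "0 \<in> ?W" using ann_scale[OF a(1), of 0] by (rule rev_image_eqI) simp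
      show "u + v \<in> ?W" if "u \<in> ?W" "v \<in> ?W" for u v
      proof -
        obtain b d where "b \<in> ann F" "d \<in> ann F" "u = b y" "v = d y" using \<open>u \<in> ?W\<close> \<open>v \<in> ?W\<close> by blast
        then show ?thesis by (intro rev_image_eqI[OF ann_add[of b F d]]) auto
      qed
      show "c *c u \<in> ?W" if "u \<in> ?W" for c u
      proof -
        obtain b where "b \<in> ann F" "u = b y" using \<open>u \<in> ?W\<close> by blast
        then show ?thesis by (intro rev_image_eqI[OF ann_scale[of b F c]]) auto
      qed
    qed
    show "?W \<subseteq> M" using ann_alg alg_in a(2) by blast
    show "s ` ?W \<subseteq> ?W" if "s \<in> S" for s
    proof clarify
      fix b assume "b \<in> ann F"
      then show "s (b y) \<in> ?W" by (rule rev_image_eqI[OF ann_step[OF that]]) simp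
    qed
  qed
  then have "m \<in> ?W" using a m by auto
  then show ?thesis by blast
qed

text \<open>The core of density, by induction on \<open>F\<close>. Suppose that y is not in the span
  of F and that no operator separates x from \<open>insert y F\<close>. Then a y \<mapsto> a x, for
  a in \<open>ann F\<close>, is a well-defined endomorphism of \<open>M\<close>. By
  \<open>schur\<close> it is a scalar \<nu>, so \<open>ann F\<close> kills x - \<nu> y; the
  induction hypothesis then puts x - \<nu> y in the span of F, a contradiction.\<close>

lemma separate:
  assumes "finite F" "F \<subseteq> M" "x \<in> M" "x \<notin> cspan F"
  shows "\<exists>a\<in>opalg S. (\<forall>y\<in>F. a y = 0) \<and> a x \<noteq> 0"
  using assms
proof (induction F arbitrary: x rule: finite_induct)
  case empty
  then show ?case by (auto intro!: bexI[OF _ opalg_id])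
next
  case (insert y F)
  have yM: "y \<in> M" and FM: "F \<subseteq> M" using insert.prems by auto
  have xF: "x \<notin> cspan F" using insert.prems cv.span_mono[of F "insert y F"] by auto
  show ?case
  proof (cases "y \<in> cspan F")
    case True
    obtain a where a: "a \<in> opalg S" "\<forall>y\<in>F. a y = 0" "a x \<noteq> 0" using insert.IH[OF FM] xF insert.prems by blast
    have "a y = (\<lambda>_. 0) y"
      by (rule cspan_induct_lin[OF True sub FM alg_lin[OF a(1)] alg_lin[OF opalg_zero]])
        (use a(2) in auto)
    with a show ?thesis by auto
  next
    case False
    then obtain a0 where a0: "a0 \<in> ann F" "a0 y \<noteq> 0"
      using insert.IH[OF FM yM] by (auto simp: ann_def)
    show ?thesis
    proof (rule ccontr)
      assume "\<not> ?thesis"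
      then have ann: "a x = 0" if "a \<in> ann F" "a y = 0" for a using that by (auto simp: ann_def)
      have "\<forall>m\<in>M. \<exists>b\<in>ann F. b y = m" using ann_cyclic[OF a0(1) yM a0(2)] by blast
      \<comment> \<open>\<open>\<beta> m\<close> is some operator of \<open>ann F\<close> with value
        \<open>m\<close> at \<open>y\<close>. Two choices differ by an operator that kills
        \<open>y\<close>, hence also \<open>x\<close>, so \<open>\<theta>\<close> below does not
        depend on the choice.\<close>
      then obtain \<beta> where \<beta>: "\<And>m. m \<in> M \<Longrightarrow> \<beta> m \<in> ann F" "\<And>m. m \<in> M \<Longrightarrow> \<beta> m y = m" by metis
      define \<theta> where "\<theta> = (\<lambda>m. \<beta> m x)"
      have \<theta>: "\<theta> (a y) = a x" if "a \<in> ann F" for a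
      proof -
        have ay: "a y \<in> M" using that ann_alg alg_in yM by blast
        have "(\<lambda>v. \<beta> (a y) v + (-1) *c a v) \<in> ann F" using ann_add[OF \<beta>(1)[OF ay] ann_scale[OF that]] .
        from ann[OF this] show ?thesis using \<beta>(2)[OF ay] by (simp add: \<theta>_def)
      qed
      have lin\<theta>: "lin_on M \<theta>"
      proof (rule lin_onI)
        show "\<theta> v \<in> M" if "v \<in> M" for v using \<beta>(1)[OF that] ann_alg alg_in insert.prems by (auto simp: \<theta>_def)
        show "\<theta> (u + w) = \<theta> u + \<theta> w" if "u \<in> M" "w \<in> M" for u w
          using \<theta>[OF ann_add[OF \<beta>(1)[OF that(1)] \<beta>(1)[OF that(2)]]] \<beta>(2) that by (simp add: \<theta>_def)
        show "\<theta> (a *c u) = a *c \<theta> u" if "u \<in> M" for a u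
          using \<theta>[OF ann_scale[OF \<beta>(1)[OF that], of a]] \<beta>(2) that by (simp add: \<theta>_def)
      qed
      have "\<forall>s\<in>S. \<forall>v\<in>M. \<theta> (s v) = s (\<theta> v)"
      proof (intro ballI)
        fix s v assume that: "s \<in> S" "v \<in> M"
        show "\<theta> (s v) = s (\<theta> v)"
          using \<theta>[OF ann_step[OF that(1) \<beta>(1)[OF that(2)]]] \<beta>(2) that by (simp add: \<theta>_def)
      qed
      from schur[OF lin\<theta> this] obtain \<nu> where \<nu>: "\<And>v. v \<in> M \<Longrightarrow> \<theta> v = \<nu> *c v" by blast
      have "x - \<nu> *c y \<notin> cspan F"
      proof
        assume "x - \<nu> *c y \<in> cspan F"
        then have "x \<in> cspan (insert y F)" by (auto simp: cv.span_breakdown_eq)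
        then show False using insert.prems by blast
      qed
      moreover have xy: "x - \<nu> *c y \<in> M"
        using insert.prems yM by (simp add: cv.subspace_diff[OF sub] cv.subspace_scale[OF sub])
      ultimately obtain a where a: "a \<in> ann F" "a (x - \<nu> *c y) \<noteq> 0"
        using insert.IH[OF FM] by (auto simp: ann_def)
      have "a (x - \<nu> *c y) = a x - \<nu> *c a y"
        using a ann_alg insert.prems yM
        by (simp add: lin_on_diff[OF alg_lin sub] lin_on_scale[OF alg_lin] cv.subspace_scale[OF sub] subset_iff)
      also have "\<dots> = 0" using \<theta>[OF a(1)] \<nu>[of "a y"] a ann_alg yM alg_in by auto
      finally show False using a by blast
    qed
  qed
qed

text \<open>It suffices to move one vector and kill the others: sums of such operators reach
  arbitrary targets for the whole family.\<close>

theorem density: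
  assumes F: "finite F" "F \<subseteq> M" "cv.independent F" "x \<in> F" and m: "m \<in> M"
  shows "\<exists>a\<in>opalg S. a x = m \<and> (\<forall>y\<in>F - {x}. a y = 0)"
proof -
  have "x \<notin> cspan (F - {x})" using F(3,4) unfolding cv.dependent_def by blast
  then obtain a where "a \<in> opalg S" "\<forall>y\<in>F - {x}. a y = 0" "a x \<noteq> 0"
    using separate[of "F - {x}" x] F by blast
  then have "\<exists>b\<in>ann (F - {x}). b x = m"
    by (intro ann_cyclic[of a]) (use F m in \<open>auto simp: ann_def\<close>)
  then show ?thesis by (auto simp: ann_def)
qed

end

section \<open>The quadratic realisation of sl2\<close>

text \<open>The bracket of p_k and p_j vanishes unless k + j = 2l, so sums of brackets collapse to
  one term. The \<open>if\<close> absorbs the boundary, where the surviving index leaves the range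
  and the term would be p_{-1} or p_{2l+1}.\<close>

lemma sum_single:
  assumes "finite I" "\<And>k. k \<in> I \<Longrightarrow> k \<noteq> k0 \<Longrightarrow> f k = 0"
  shows "sum f I = (if k0 \<in> I then f k0 else (0::'a::comm_monoid_add))"
proof -
  have "sum f I = sum (\<lambda>k. if k = k0 then f k0 else 0) I"
    by (rule sum.cong) (use assms(2) in auto)
  then show ?thesis using assms(1) by (simp add: sum.delta)
qed

text \<open>As 2n+1 is odd, k \<mapsto> 2n+1-k has no fixed point and swaps the two halves. This
  folds the sum obtained from [e, f] to the range used by \<open>\<phi> GH\<close>.\<close>

lemma sum_reflect_half:
  fixes F :: "nat \<Rightarrow> 'a::comm_monoid_add"
  shows "(\<Sum>k=0..2*n+1. F k) = (\<Sum>k=0..n. F k + F (2*n+1-k))"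
proof -
  have "(\<Sum>k=0..2*n+1. F k) = (\<Sum>k=0..n. F k) + (\<Sum>k=n+1..2*n+1. F k)"
    using sum.ub_add_nat[of 0 n F "n+1"] by (simp add: mult_2)
  also have "(\<Sum>k=n+1..2*n+1. F k) = (\<Sum>k=0..n. F (2*n+1-k))"
    by (rule sum.reindex_bij_witness[of _ "\<lambda>k. 2*n+1-k" "\<lambda>k. 2*n+1-k"]) auto
  finally show ?thesis by (simp add: sum.distrib)
qed

text \<open>Here \<open>s\<close> is the power of -1 shared by the coefficients of Phi and
  \<open>pp_coeff\<close>, and \<open>x\<close>, \<open>y\<close> are factorials; the two summands
  come from the two factors of a quadratic term.\<close>

lemma sign_cancel:
  fixes s x y z a b :: complex
  assumes "s * s = 1"
  shows "s * a / (x * y) * (s * z) + s * b / (y * x) * (s * z) = z / (x * y) * (a + b)"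
proof -
  have "s * a / (x * y) * (s * z) + s * b / (y * x) * (s * z) = (s * s) * (z / (x * y) * (a + b))"
    by (simp add: add_divide_distrib algebra_simps)
  then show ?thesis by (simp add: assms)
qed

text \<open>Instantiated with \<open>M\<close> for (i) and with \<open>V\<close> for (ii).\<close>

locale heis =
  fixes n :: nat and V :: "'v::cvec set" and act :: "gen \<Rightarrow> 'v \<Rightarrow> 'v" and c :: complex
  assumes mod: "heis_mod n V act" and c0: "c \<noteq> 0" and Z: "\<And>v. v \<in> V \<Longrightarrow> act GZ v = c *c v"
begin

abbreviation P :: "nat \<Rightarrow> 'v \<Rightarrow> 'v" where "P k \<equiv> act (GP k)"

lemma sub: "csubspace V"
  using mod by (simp add: heis_mod_def)

lemma gen_lin: "\<forall>s\<in>act ` heis_gens n. lin_on V s"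
  using mod by (simp add: heis_mod_def)

lemma P_lin: "k \<le> 2*n+1 \<Longrightarrow> lin_on V (P k)"
  using gen_lin by (auto simp: heis_gens_def)

lemmas P_in = lin_on_in[OF P_lin]
lemmas P_scale = lin_on_scale[OF P_lin]

lemma P_comm:
  assumes "v \<in> V" "k \<le> 2*n+1" "k' \<le> 2*n+1"
  shows "comm (P k) (P k') v = (pp_coeff n k k' * c) *c v"
proof -
  have "comm (P k) (P k') v = pp_coeff n k k' *c act GZ v"
    using mod assms unfolding heis_mod_def by blast
  then show ?thesis by (simp add: Z assms cscale_cscale)
qed

text \<open>The common shape of the three images under Phi, up to the constant in h, so that the
  Leibniz rule is proved only once.\<close>

definition quad :: "complex \<Rightarrow> nat set \<Rightarrow> (nat \<Rightarrow> complex) \<Rightarrow> (nat \<Rightarrow> nat) \<Rightarrow> (nat \<Rightarrow> nat) \<Rightarrow> 'v \<Rightarrow> 'v" where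
  "quad d I a i j v = d *c (\<Sum>k\<in>I. a k *c P (i k) (P (j k) v))"

lemma quad_comm:
  assumes X: "lin_on V X" and v: "v \<in> V"
    and i: "\<And>k. k \<in> I \<Longrightarrow> i k \<le> 2*n+1" and j: "\<And>k. k \<in> I \<Longrightarrow> j k \<le> 2*n+1"
  shows "comm X (quad d I a i j) v
    = d *c (\<Sum>k\<in>I. a k *c (comm X (P (i k)) (P (j k) v) + P (i k) (comm X (P (j k)) v)))"
proof -
  have in1: "P (i k) (P (j k) w) \<in> V" if "k \<in> I" "w \<in> V" for k w
    using that i j by (intro P_in) auto
  have "X (quad d I a i j v) = d *c (\<Sum>k\<in>I. a k *c X (P (i k) (P (j k) v)))"
    by (simp add: quad_def lin_on_scale[OF X] cv.subspace_sum[OF sub] cv.subspace_scale[OF sub] in1 v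
        lin_on_sum[OF X sub])
  then have "comm X (quad d I a i j) v
    = d *c (\<Sum>k\<in>I. a k *c (X (P (i k) (P (j k) v)) - P (i k) (P (j k) (X v))))"
    by (simp add: quad_def cv.scale_right_diff_distrib sum_subtractf)
  also have "\<dots> = d *c (\<Sum>k\<in>I. a k *c (comm X (P (i k)) (P (j k) v) + P (i k) (comm X (P (j k)) v)))"
  proof (intro arg_cong[of _ _ "\<lambda>x. d *c x"] sum.cong refl arg_cong[of _ _ "\<lambda>x. _ *c x"])
    fix k assume k: "k \<in> I"
    have "P (i k) (comm X (P (j k)) v) = P (i k) (X (P (j k) v)) - P (i k) (P (j k) (X v))"
      by (rule lin_on_diff[OF P_lin[OF i[OF k]] sub lin_on_in[OF X P_in[OF j[OF k] v]]
            P_in[OF j[OF k] lin_on_in[OF X v]]])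
    then show "X (P (i k) (P (j k) v)) - P (i k) (P (j k) (X v))
      = comm X (P (i k)) (P (j k) v) + P (i k) (comm X (P (j k)) v)" by simp
  qed
  finally show ?thesis .
qed

abbreviation \<phi> :: "gen \<Rightarrow> 'v \<Rightarrow> 'v" where "\<phi> \<equiv> phi_act n c act"

definition ce :: "nat \<Rightarrow> complex" where
  "ce k = (-1)^(k+n+1) * (of_nat n + 1/2 - of_nat k) / (of_nat (fact (k - 1)) * of_nat (fact (2*n+1-k)))"
definition cf :: "nat \<Rightarrow> complex" where
  "cf k = (-1)^(k+n) * (of_nat n + 1/2 - of_nat k) / (of_nat (fact (k - 1)) * of_nat (fact (2*n+1-k)))"
definition ch :: "nat \<Rightarrow> complex" where
  "ch k = (-1)^(k+n) * (of_nat n + 1/2 - of_nat k) / (of_nat (fact k) * of_nat (fact (2*n+1-k)))"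

lemma \<phi>_GE: "\<phi> GE = quad (1/c) {1..2*n+1} ce (\<lambda>k. k - 1) (\<lambda>k. 2*n+1-k)"
  by (simp add: fun_eq_iff phi_act_def quad_def ce_def)

lemma \<phi>_GF: "\<phi> GF = quad (1/c) {1..2*n+1} cf (\<lambda>k. k) (\<lambda>k. 2*n+2-k)"
  by (simp add: fun_eq_iff phi_act_def quad_def cf_def)

lemma \<phi>_GH: "\<phi> GH v = quad (2/c) {0..n} ch (\<lambda>k. 2*n+1-k) (\<lambda>k. k) v - ((of_nat n + 1)^2 / 2) *c v"
  by (simp add: phi_act_def quad_def ch_def)

lemma \<phi>_GP [simp]: "\<phi> (GP k) = P k"
  by (simp add: fun_eq_iff phi_act_def)

lemma \<phi>_GZ [simp]: "\<phi> GZ = act GZ"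
  by (simp add: fun_eq_iff phi_act_def)

lemma quad_opalg:
  assumes "\<And>k. k \<in> I \<Longrightarrow> i k \<le> 2*n+1" "\<And>k. k \<in> I \<Longrightarrow> j k \<le> 2*n+1"
  shows "quad d I a i j \<in> opalg (act ` heis_gens n)"
proof -
  have g: "P k \<in> act ` heis_gens n" if "k \<le> 2*n+1" for k
    using that by (auto simp: heis_gens_def)
  have t: "(\<lambda>v. a k *c P (i k) (P (j k) v)) \<in> opalg (act ` heis_gens n)" if "k \<in> I" for k
    using assms[OF that]
    by (intro opalg_scale opalg_step[of "P (i k)" _ "P (j k)"] opalg_gen g)
  show ?thesis
    unfolding quad_def[abs_def] by (rule opalg_scale[OF opalg_sum[OF t]])
qed

text \<open>Being polynomials in the p_k, the images of sl2 preserve every Heisenberg submodule and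
  commute with whatever commutes with the Heisenberg algebra.\<close>

lemma \<phi>_opalg:
  assumes "x \<in> all_gens n"
  shows "\<phi> x \<in> opalg (act ` heis_gens n)"
proof -
  have "\<phi> GE \<in> opalg (act ` heis_gens n)" "\<phi> GF \<in> opalg (act ` heis_gens n)"
    unfolding \<phi>_GE \<phi>_GF by (rule quad_opalg; auto)+
  moreover have "\<phi> GH \<in> opalg (act ` heis_gens n)"
    unfolding \<phi>_GH[abs_def]
    by (intro opalg_diff quad_opalg opalg_scale opalg_id) auto
  moreover have "\<phi> x \<in> opalg (act ` heis_gens n)" if "x \<in> heis_gens n"
  proof -
    have "\<phi> x = act x" using that by (auto simp: heis_gens_def)
    then show ?thesis using that by (simp add: opalg_gen)
  qed
  ultimately show ?thesis using assms by (auto simp: all_gens_def sl2_gens_def)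
qed

lemma \<phi>_lin: "x \<in> all_gens n \<Longrightarrow> lin_on V (\<phi> x)"
  by (rule opalg_lin[OF sub gen_lin \<phi>_opalg])

section \<open>Brackets of the p_k with the quadratic operators\<close>

lemma P_quad_comm:
  assumes v: "v \<in> V" and m: "m \<le> 2*n+1"
    and i: "\<And>k. k \<in> I \<Longrightarrow> i k \<le> 2*n+1" and j: "\<And>k. k \<in> I \<Longrightarrow> j k \<le> 2*n+1"
  shows "comm (P m) (quad d I a i j) v
    = d *c (\<Sum>k\<in>I. (a k * pp_coeff n m (i k) * c) *c P (j k) v)
    + d *c (\<Sum>k\<in>I. (a k * pp_coeff n m (j k) * c) *c P (i k) v)"
proof -
  have "comm (P m) (quad d I a i j) v = d *c (\<Sum>k\<in>I. a k *c (comm (P m) (P (i k)) (P (j k) v)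
      + P (i k) (comm (P m) (P (j k)) v)))"
    by (rule quad_comm[OF P_lin[OF m] v i j])
  also have "\<dots> = d *c (\<Sum>k\<in>I. (a k * pp_coeff n m (i k) * c) *c P (j k) v
      + (a k * pp_coeff n m (j k) * c) *c P (i k) v)"
  proof (intro arg_cong[of _ _ "\<lambda>x. d *c x"] sum.cong refl)
    fix k assume k: "k \<in> I"
    show "a k *c (comm (P m) (P (i k)) (P (j k) v) + P (i k) (comm (P m) (P (j k)) v))
      = (a k * pp_coeff n m (i k) * c) *c P (j k) v + (a k * pp_coeff n m (j k) * c) *c P (i k) v"
      using k i[OF k] j[OF k] m v
      by (simp only: P_comm P_in P_scale cscale_right_distrib cscale_cscale mult.assoc)
  qed
  finally show ?thesis by (simp add: sum.distrib cscale_right_distrib)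
qed

lemma pp_coeff_diag:
  "m \<le> 2*n+1 \<Longrightarrow> pp_coeff n m (2*n+1-m) = (-1)^(m+n+1) * of_nat (fact m) * of_nat (fact (2*n+1-m))"
  by (simp add: pp_coeff_def)

text \<open>Two summands survive, at k = 2l+1-m through the left factor and at k = m through the
  right one; both are multiples of p_{m-1}. The factorials reduce to m, and the two weights l-k add
  up to -1.\<close>

lemma P_GE_comm:
  assumes v: "v \<in> V" and m: "m \<le> 2*n+1"
  shows "comm (P m) (\<phi> GE) v = - (of_nat m *c P (m - 1) v)"
proof -
  have eq: "comm (P m) (\<phi> GE) v
    = (1/c) *c (\<Sum>k\<in>{1..2*n+1}. (ce k * pp_coeff n m (k-1) * c) *c P (2*n+1-k) v)
    + (1/c) *c (\<Sum>k\<in>{1..2*n+1}. (ce k * pp_coeff n m (2*n+1-k) * c) *c P (k-1) v)"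
    unfolding \<phi>_GE by (rule P_quad_comm[OF v m]) auto
  have s1: "(\<Sum>k\<in>{1..2*n+1}. (ce k * pp_coeff n m (k-1) * c) *c P (2*n+1-k) v)
    = (if 2*n+2-m \<in> {1..2*n+1} then (ce (2*n+2-m) * pp_coeff n m (2*n+2-m-1) * c) *c P (2*n+1-(2*n+2-m)) v else 0)"
    by (rule sum_single) (use m in \<open>auto simp: pp_coeff_def\<close>)
  have s2: "(\<Sum>k\<in>{1..2*n+1}. (ce k * pp_coeff n m (2*n+1-k) * c) *c P (k-1) v)
    = (if m \<in> {1..2*n+1} then (ce m * pp_coeff n m (2*n+1-m) * c) *c P (m-1) v else 0)"
    by (rule sum_single) (use m in \<open>auto simp: pp_coeff_def\<close>)
  show ?thesis
  proof (cases m)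
    case 0
    then show ?thesis unfolding eq s1 s2 by simp
  next
    case (Suc p)
    \<comment> \<open>With p = m-1 and q = 2n+1-m the truncated subtractions disappear; as p + q is
      even, the signs at both indices agree.\<close>
    then obtain q where q: "2 * n = p + q" using m by (metis le_Suc_ex Suc_le_mono Suc_eq_plus1)
    have idx: "2*n+2-m = Suc q" "Suc q - 1 = q" "2*n+1-Suc q = p" "2*n+1-m = q" "m - 1 = p"
      using q Suc by auto
    have pp: "pp_coeff n m q = (-1)^(m+n+1) * of_nat (fact m) * of_nat (fact q)"
      using pp_coeff_diag[OF m] unfolding idx .
    have sgn: "(-1::complex)^(Suc q+n+1) = (-1)^(p+n)"
      using q by (simp add: minus_one_power_iff) presburger
    have cn: "(of_nat n :: complex) = (of_nat p + of_nat q) / 2"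
      using arg_cong[OF q, of "of_nat :: nat \<Rightarrow> complex"] by (simp add: field_simps)
    have "ce (Suc q) * pp_coeff n m q + ce m * pp_coeff n m q = - of_nat m"
    proof -
      have "ce (Suc q) = (-1)^(p+n) * (of_nat n + 1/2 - of_nat (Suc q)) / (of_nat (fact q) * of_nat (fact p))"
        using sgn idx Suc by (simp add: ce_def)
      moreover have "ce m = (-1)^(p+n) * (of_nat n + 1/2 - of_nat m) / (of_nat (fact p) * of_nat (fact q))"
        using idx Suc by (simp add: ce_def)
      moreover have "pp_coeff n m q = (-1)^(p+n) * (of_nat (fact m) * of_nat (fact q))"
        using pp Suc by simp
      moreover have "((-1)^(p+n) :: complex) * (-1)^(p+n) = 1"
        by (simp flip: power_mult_distrib)
      ultimately have "ce (Suc q) * pp_coeff n m q + ce m * pp_coeff n m q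
        = (of_nat (fact m) * of_nat (fact q)) / (of_nat (fact q) * of_nat (fact p))
          * ((of_nat n + 1/2 - of_nat (Suc q)) + (of_nat n + 1/2 - of_nat m))"
        using sign_cancel by metis
      also have "\<dots> = - of_nat m"
        by (simp add: Suc cn field_simps)
      finally show ?thesis .
    qed
    moreover have "(1/c) *c (ce (Suc q) * pp_coeff n m q * c) *c P p v + (1/c) *c (ce m * pp_coeff n m q * c) *c P p v
       = (ce (Suc q) * pp_coeff n m q + ce m * pp_coeff n m q) *c P p v"
      using c0 by (simp add: cscale_cscale cscale_left_distrib)
    ultimately have "(1/c) *c (ce (Suc q) * pp_coeff n m q * c) *c P p v
        + (1/c) *c (ce m * pp_coeff n m q * c) *c P p v = (- of_nat m) *c P p v"
      by (simp only:)
    moreover have "Suc q \<in> {1..2*n+1}" "m \<in> {1..2*n+1}" using q Suc by auto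
    ultimately show ?thesis
      unfolding eq s1 s2 idx by (simp only: if_True cv.scale_minus_left)
  qed
qed

text \<open>As for e: the summands at k = 2l-m and k = m+1 survive, both give p_{m+1}, and their
  weights again add up to -1.\<close>

lemma P_GF_comm:
  assumes v: "v \<in> V" and m: "m \<le> 2*n+1"
  shows "comm (P m) (\<phi> GF) v = - (of_nat (2*n+1-m) *c P (m + 1) v)"
proof -
  have eq: "comm (P m) (\<phi> GF) v
    = (1/c) *c (\<Sum>k\<in>{1..2*n+1}. (cf k * pp_coeff n m k * c) *c P (2*n+2-k) v)
    + (1/c) *c (\<Sum>k\<in>{1..2*n+1}. (cf k * pp_coeff n m (2*n+2-k) * c) *c P k v)"
    unfolding \<phi>_GF by (rule P_quad_comm[OF v m]) auto
  have s1: "(\<Sum>k\<in>{1..2*n+1}. (cf k * pp_coeff n m k * c) *c P (2*n+2-k) v)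
    = (if 2*n+1-m \<in> {1..2*n+1} then (cf (2*n+1-m) * pp_coeff n m (2*n+1-m) * c) *c P (2*n+2-(2*n+1-m)) v else 0)"
    by (rule sum_single) (use m in \<open>auto simp: pp_coeff_def\<close>)
  have s2: "(\<Sum>k\<in>{1..2*n+1}. (cf k * pp_coeff n m (2*n+2-k) * c) *c P k v)
    = (if m+1 \<in> {1..2*n+1} then (cf (m+1) * pp_coeff n m (2*n+2-(m+1)) * c) *c P (m+1) v else 0)"
    by (rule sum_single) (use m in \<open>auto simp: pp_coeff_def\<close>)
  show ?thesis
  proof (cases "2*n+1-m")
    \<comment> \<open>Here m = 2n+1: both surviving indices leave the range, which matches the
      coefficient 0 in front of \<open>P (m + 1)\<close>.\<close>
    case 0
    then show ?thesis unfolding eq s1 s2 using m by simp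
  next
    case (Suc q)
    have q: "2 * n = m + q" using Suc m by auto
    have idx: "2*n+2-(m+1) = Suc q" "2*n+2-Suc q = m + 1" "2*n+1-m = Suc q" "2*n+1-Suc q = m" "2*n+1-(m+1) = q"
      using q by auto
    have sgn: "(-1::complex)^(Suc q+n) = (-1)^(m+n+1)"
      using q by (simp add: minus_one_power_iff) presburger
    have cn: "(of_nat n :: complex) = (of_nat m + of_nat q) / 2"
      using arg_cong[OF q, of "of_nat :: nat \<Rightarrow> complex"] by (simp add: field_simps)
    have "cf (Suc q) * pp_coeff n m (Suc q) + cf (m+1) * pp_coeff n m (Suc q) = - of_nat (Suc q)"
    proof -
      have "cf (Suc q) = (-1)^(m+n+1) * (of_nat n + 1/2 - of_nat (Suc q)) / (of_nat (fact q) * of_nat (fact m))"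
        using sgn idx by (simp add: cf_def)
      moreover have "cf (m+1) = (-1)^(m+n+1) * (of_nat n + 1/2 - of_nat (m+1)) / (of_nat (fact m) * of_nat (fact q))"
        using idx by (simp add: cf_def)
      moreover have "pp_coeff n m (Suc q) = (-1)^(m+n+1) * (of_nat (fact m) * of_nat (fact (Suc q)))"
        using pp_coeff_diag[OF m] unfolding idx by (simp only: mult.assoc)
      moreover have "((-1)^(m+n+1) :: complex) * (-1)^(m+n+1) = 1"
        by (simp flip: power_mult_distrib)
      ultimately have "cf (Suc q) * pp_coeff n m (Suc q) + cf (m+1) * pp_coeff n m (Suc q)
        = (of_nat (fact m) * of_nat (fact (Suc q))) / (of_nat (fact q) * of_nat (fact m))
          * ((of_nat n + 1/2 - of_nat (Suc q)) + (of_nat n + 1/2 - of_nat (m+1)))"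
        using sign_cancel by metis
      also have "\<dots> = - of_nat (Suc q)"
        by (simp add: cn field_simps)
      finally show ?thesis .
    qed
    moreover have "(1/c) *c (cf (Suc q) * pp_coeff n m (Suc q) * c) *c P (m+1) v
        + (1/c) *c (cf (m+1) * pp_coeff n m (Suc q) * c) *c P (m+1) v
       = (cf (Suc q) * pp_coeff n m (Suc q) + cf (m+1) * pp_coeff n m (Suc q)) *c P (m+1) v"
      using c0 by (simp add: cscale_cscale cscale_left_distrib)
    ultimately have "(1/c) *c (cf (Suc q) * pp_coeff n m (Suc q) * c) *c P (m+1) v
        + (1/c) *c (cf (m+1) * pp_coeff n m (Suc q) * c) *c P (m+1) v = (- of_nat (Suc q)) *c P (m+1) v"
      by (simp only:)
    moreover have "Suc q \<in> {1..2*n+1}" "m+1 \<in> {1..2*n+1}" using q Suc by auto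
    ultimately show ?thesis
      unfolding eq s1 s2 idx by (simp only: if_True cv.scale_minus_left)
  qed
qed

text \<open>The sum in \<open>\<phi> GH\<close> stops at n, so exactly one summand survives: at k =
  m if m \<le> n, and at the mirror index 2n+1-m otherwise. The additive constant commutes with
  \<open>P m\<close>.\<close>

lemma P_GH_comm:
  assumes v: "v \<in> V" and m: "m \<le> 2*n+1"
  shows "comm (P m) (\<phi> GH) v = - ((2 * (of_nat n + 1/2 - of_nat m)) *c P m v)"
proof -
  let ?Q = "quad (2/c) {0..n} ch (\<lambda>k. 2*n+1-k) (\<lambda>k. k)"
  have Q: "lin_on V ?Q" by (rule opalg_lin[OF sub gen_lin quad_opalg]) auto
  have "comm (P m) (\<phi> GH) v = comm (P m) ?Q v"
    unfolding \<phi>_GH lin_on_diff[OF P_lin[OF m] sub lin_on_in[OF Q v] cv.subspace_scale[OF sub v]]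
      P_scale[OF m v] by (simp only: diff_diff_eq2 diff_add_cancel)
  also have "\<dots> = (2/c) *c (\<Sum>k\<in>{0..n}. (ch k * pp_coeff n m (2*n+1-k) * c) *c P k v)
    + (2/c) *c (\<Sum>k\<in>{0..n}. (ch k * pp_coeff n m k * c) *c P (2*n+1-k) v)"
    by (rule P_quad_comm[OF v m]) auto
  also have "(\<Sum>k\<in>{0..n}. (ch k * pp_coeff n m (2*n+1-k) * c) *c P k v)
    = (if m \<in> {0..n} then (ch m * pp_coeff n m (2*n+1-m) * c) *c P m v else 0)"
    by (rule sum_single) (use m in \<open>auto simp: pp_coeff_def\<close>)
  also have "(\<Sum>k\<in>{0..n}. (ch k * pp_coeff n m k * c) *c P (2*n+1-k) v)
    = (if 2*n+1-m \<in> {0..n} then (ch (2*n+1-m) * pp_coeff n m (2*n+1-m) * c) *c P (2*n+1-(2*n+1-m)) v else 0)"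
    by (rule sum_single) (use m in \<open>auto simp: pp_coeff_def\<close>)
  finally have eq: "comm (P m) (\<phi> GH) v
    = (2/c) *c (if m \<in> {0..n} then (ch m * pp_coeff n m (2*n+1-m) * c) *c P m v else 0)
    + (2/c) *c (if 2*n+1-m \<in> {0..n} then (ch (2*n+1-m) * pp_coeff n m (2*n+1-m) * c) *c P (2*n+1-(2*n+1-m)) v else 0)" .
  have sq: "((-1)^(m+n) :: complex) * (-1)^(m+n) = 1" by (simp flip: power_mult_distrib)
  have f: "of_nat (fact m) * of_nat (fact (2*n+1-m)) \<noteq> (0::complex)" by simp
  show ?thesis
  proof (cases "m \<le> n")
    case True
    have "ch m * pp_coeff n m (2*n+1-m) = - (((-1)^(m+n) * (-1)^(m+n)) * (of_nat n + 1/2 - of_nat m))"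
      unfolding ch_def pp_coeff_diag[OF m] by (simp add: field_simps)
    then have "ch m * pp_coeff n m (2*n+1-m) = - (of_nat n + 1/2 - of_nat m)" unfolding sq by simp
    moreover have "\<not> 2*n+1-m \<le> n" using True by simp
    ultimately show ?thesis unfolding eq using True c0
      by (simp add: cscale_cscale flip: cv.scale_minus_left)
  next
    case False
    have e: "2*n+1-(2*n+1-m) = m" using m by simp
    \<comment> \<open>Reflection changes the parity of the exponent and also the sign of l-k, so the
      two cases agree.\<close>
    have sgn: "(-1::complex)^(2*n+1-m+n) = - ((-1)^(m+n))"
      using m by (simp add: minus_one_power_iff)
    have cn: "(of_nat (2*n+1-m) :: complex) = 2 * of_nat n + 1 - of_nat m" using m by (simp add: of_nat_diff)
    have "ch (2*n+1-m) * pp_coeff n m (2*n+1-m)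
      = ((-1)^(m+n) * (-1)^(m+n)) * (of_nat n + 1/2 - of_nat (2*n+1-m))"
      unfolding ch_def pp_coeff_diag[OF m] e sgn by (simp add: field_simps)
    then have "ch (2*n+1-m) * pp_coeff n m (2*n+1-m) = - (of_nat n + 1/2 - of_nat m)"
      unfolding sq cn by simp
    moreover have "2*n+1-m \<le> n" using False by simp
    ultimately show ?thesis unfolding eq e using False m c0
      by (simp add: cscale_cscale flip: cv.scale_minus_left)
  qed
qed

section \<open>The sl2 relations among the quadratic operators\<close>

text \<open>p_k has weight 2(l-k), so p_i p_j has weight 4l - 2(i+j), where 4l = 4n+2. The terms of
  e have i+j = 2n and those of f have i+j = 2n+2, which gives the weights 2 and -2.\<close>

lemma GH_quad_comm:
  assumes X: "lin_on V X" and v: "v \<in> V"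
    and XP: "\<And>k w. k \<le> 2*n+1 \<Longrightarrow> w \<in> V \<Longrightarrow> comm X (P k) w = (2 * (of_nat n + 1/2 - of_nat k)) *c P k w"
    and i: "\<And>k. k \<in> I \<Longrightarrow> i k \<le> 2*n+1" and j: "\<And>k. k \<in> I \<Longrightarrow> j k \<le> 2*n+1"
    and w: "\<And>k. k \<in> I \<Longrightarrow> i k + j k = w"
  shows "comm X (quad d I a i j) v = (4 * of_nat n + 2 - 2 * of_nat w) *c quad d I a i j v"
proof -
  have "comm X (quad d I a i j) v = d *c (\<Sum>k\<in>I. a k *c (comm X (P (i k)) (P (j k) v)
      + P (i k) (comm X (P (j k)) v)))"
    by (rule quad_comm[OF X v i j])
  also have "\<dots> = d *c (\<Sum>k\<in>I. a k *c ((4 * of_nat n + 2 - 2 * of_nat w) *c P (i k) (P (j k) v)))"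
  proof (intro arg_cong[of _ _ "\<lambda>x. d *c x"] sum.cong refl arg_cong[of _ _ "\<lambda>x. _ *c x"])
    fix k assume k: "k \<in> I"
    have "comm X (P (i k)) (P (j k) v) + P (i k) (comm X (P (j k)) v)
      = (2 * (of_nat n + 1/2 - of_nat (i k)) + 2 * (of_nat n + 1/2 - of_nat (j k))) *c P (i k) (P (j k) v)"
      using i[OF k] j[OF k] v by (simp only: XP P_in P_scale cscale_left_distrib)
    also have "2 * (of_nat n + 1/2 - of_nat (i k)) + 2 * (of_nat n + 1/2 - of_nat (j k))
      = 4 * of_nat n + 2 - 2 * (of_nat w :: complex)"
      unfolding w[OF k, symmetric] by (simp add: algebra_simps)
    finally show "comm X (P (i k)) (P (j k) v) + P (i k) (comm X (P (j k)) v)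
      = (4 * of_nat n + 2 - 2 * of_nat w) *c P (i k) (P (j k) v)" .
  qed
  finally show ?thesis
    by (simp add: quad_def cv.scale_sum_right cscale_cscale mult_ac)
qed

text \<open>In the bracket of \<open>X\<close> with \<open>\<phi> GF\<close>, moving the factor \<open>P k\<close> with \<open>k \<le> n\<close> to the right
  of \<open>P (2*n+1-k)\<close> costs the scalar \<open>g k\<close>; these add up to the constant in \<open>\<phi> GH\<close>.\<close>
definition g :: "nat \<Rightarrow> complex" where
  "g k = (of_nat n + 1/2 - of_nat k) * (2 * of_nat n + 2 - of_nat k) * of_nat k
     - (of_nat n - 1/2 - of_nat k) * (of_nat k + 1) * (2 * of_nat n + 1 - of_nat k)"

lemma sum_g: "(\<Sum>k=0..n. g k) = (of_nat n + 1)^2 / 2"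
proof -
  \<comment> \<open>\<open>n\<close> occurs in \<open>g\<close>, so the induction needs a separate
    upper limit \<open>N\<close>.\<close>
  have closed: "(\<Sum>k=0..N. g k) = (of_nat N + 1) * (1/2 - 2 * (of_nat n)^2 + (6 * of_nat n + 2) * of_nat N / 2
      - of_nat N * (2 * of_nat N + 1) / 2)" for N
  proof (induction N)
    case (Suc N)
    show ?case unfolding sum.atLeast0_atMost_Suc Suc by (simp add: g_def field_simps power2_eq_square)
  qed (simp add: g_def field_simps power2_eq_square)
  show ?thesis unfolding closed by (simp add: field_simps power2_eq_square)
qed

text \<open>By Leibniz, [e, f] is a sum of products \<open>?X k\<close> with index sum 2l. Pairing k
  with 2n+1-k and reordering to p_{2l-k} p_k produces the coefficients \<open>2 * ch k\<close> and
  leaves the scalars \<open>g k\<close>.\<close>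

lemma GE_GF_comm:
  assumes X: "lin_on V X" and v: "v \<in> V"
    and XP: "\<And>k w. k \<le> 2*n+1 \<Longrightarrow> w \<in> V \<Longrightarrow> comm X (P k) w = of_nat k *c P (k - 1) w"
  shows "comm X (\<phi> GF) v = \<phi> GH v"
proof -
  let ?X = "\<lambda>k. P k (P (2*n+1-k) v)"
  define C where "C = (\<lambda>k. (-1)^(k+n) * g k / (of_nat (fact k) * of_nat (fact (2*n+1-k))))"
  have "comm X (\<phi> GF) v = (1/c) *c (\<Sum>k\<in>{1..2*n+1}. cf k *c (comm X (P k) (P (2*n+2-k) v)
      + P k (comm X (P (2*n+2-k)) v)))"
    unfolding \<phi>_GF by (rule quad_comm[OF X v]) auto
  also have "(\<Sum>k\<in>{1..2*n+1}. cf k *c (comm X (P k) (P (2*n+2-k) v) + P k (comm X (P (2*n+2-k)) v)))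
    = (\<Sum>k\<in>{1..2*n+1}. (cf k * of_nat k) *c ?X (k - 1) + (cf k * (2 * of_nat n + 2 - of_nat k)) *c ?X k)"
  proof (intro sum.cong refl)
    fix k assume k: "k \<in> {1..2*n+1}"
    have "comm X (P k) (P (2*n+2-k) v) = of_nat k *c ?X (k-1)"
    proof -
      have "2*n+1-(k-1) = 2*n+2-k" using k by auto
      moreover have "k \<le> 2*n+1" "2*n+2-k \<le> 2*n+1" using k by auto
      ultimately show ?thesis using XP[of k "P (2*n+2-k) v"] P_in[of "2*n+2-k" v] v by metis
    qed
    moreover have "P k (comm X (P (2*n+2-k)) v) = of_nat (2*n+2-k) *c ?X k"
    proof -
      have "2*n+2-k-1 = 2*n+1-k" "k \<le> 2*n+1" "2*n+2-k \<le> 2*n+1" "2*n+1-k \<le> 2*n+1" using k by auto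
      then show ?thesis using XP[of "2*n+2-k" v] P_scale[of k "P (2*n+1-k) v"] P_in[of "2*n+1-k" v] v by metis
    qed
    moreover have "(of_nat (2*n+2-k) :: complex) = 2 * of_nat n + 2 - of_nat k"
      using k by (simp add: of_nat_diff)
    ultimately show "cf k *c (comm X (P k) (P (2*n+2-k) v) + P k (comm X (P (2*n+2-k)) v))
      = (cf k * of_nat k) *c ?X (k - 1) + (cf k * (2 * of_nat n + 2 - of_nat k)) *c ?X k"
      by (simp only: cscale_right_distrib cscale_cscale)
  qed
  also have "\<dots> = (\<Sum>k=0..2*n+1. C k *c ?X k)"
  proof -
    \<comment> \<open>\<open>A1\<close> collects the terms where \<open>X\<close> meets the left
      factor, after a shift of k by one, and \<open>A2\<close> those where it meets the right
      factor, both over the denominator of \<open>ch\<close>.\<close>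
    define A1 :: "nat \<Rightarrow> complex" where "A1 = (\<lambda>k. (-1)^(k+n+1) * (of_nat n - 1/2 - of_nat k) * (of_nat k + 1) * (2 * of_nat n + 1 - of_nat k)
        / (of_nat (fact k) * of_nat (fact (2*n+1-k))))"
    define A2 :: "nat \<Rightarrow> complex" where "A2 = (\<lambda>k. (-1)^(k+n) * (of_nat n + 1/2 - of_nat k) * (2 * of_nat n + 2 - of_nat k) * of_nat k
        / (of_nat (fact k) * of_nat (fact (2*n+1-k))))"
    have "(\<Sum>k\<in>{1..2*n+1}. (cf k * of_nat k) *c ?X (k - 1)) = (\<Sum>k=0..2*n. (cf (k+1) * of_nat (k+1)) *c ?X k)"
      by (rule sum.reindex_bij_witness[of _ "\<lambda>k. k+1" "\<lambda>k. k-1"]) auto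
    also have "\<dots> = (\<Sum>k=0..2*n. A1 k *c ?X k)"
    proof (intro sum.cong refl)
      fix k assume "k \<in> {0..2*n}"
      then obtain q where q: "2*n = k + q" by (auto simp: le_iff_add)
      have cn: "(of_nat n :: complex) = (of_nat k + of_nat q) / 2"
        using arg_cong[OF q, of "of_nat :: nat \<Rightarrow> complex"] by (simp add: field_simps)
      have s: "2*n+1-(k+1) = q" "2*n+1-k = Suc q" using q by auto
      have "2 * of_nat n + 1 - of_nat k = (of_nat (Suc q) :: complex)" by (simp add: cn field_simps)
      then have "A1 k = (-1)^(k+n+1) * (of_nat n - 1/2 - of_nat k) * (of_nat k + 1) * of_nat (Suc q)
          / (of_nat (fact k) * (of_nat (Suc q) * of_nat (fact q)))"
        unfolding A1_def s by (simp only: fact_Suc of_nat_mult of_nat_id)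
      also have "\<dots> = (-1)^(k+n+1) * (of_nat n - 1/2 - of_nat k) * (of_nat k + 1)
          / (of_nat (fact k) * of_nat (fact q))"
        by (simp del: of_nat_Suc)
      also have "\<dots> = cf (k+1) * of_nat (k+1)"
        unfolding cf_def s by (simp add: algebra_simps)
      finally have "cf (k+1) * of_nat (k+1) = A1 k" ..
      then show "(cf (k+1) * of_nat (k+1)) *c ?X k = A1 k *c ?X k" by (simp only:)
    qed
    \<comment> \<open>The added top term is zero by the factor 2n+1-k; likewise \<open>A2\<close>
      below gains a term at 0, which is zero by the factor k.\<close>
    also have "\<dots> = (\<Sum>k=0..2*n+1. A1 k *c ?X k)"
      by (simp add: A1_def)
    finally have 1: "(\<Sum>k\<in>{1..2*n+1}. (cf k * of_nat k) *c ?X (k - 1)) = (\<Sum>k=0..2*n+1. A1 k *c ?X k)" .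
    have "(\<Sum>k\<in>{1..2*n+1}. (cf k * (2 * of_nat n + 2 - of_nat k)) *c ?X k) = (\<Sum>k\<in>{1..2*n+1}. A2 k *c ?X k)"
    proof (intro sum.cong refl)
      fix k assume "k \<in> {1..2*n+1}"
      then obtain p where p: "k = Suc p" by (cases k) auto
      have "A2 k = (-1)^(k+n) * (of_nat n + 1/2 - of_nat k) * (2 * of_nat n + 2 - of_nat k) * of_nat (Suc p)
          / (of_nat (Suc p) * of_nat (fact p) * of_nat (fact (2*n+1-k)))"
        unfolding A2_def p by (simp only: fact_Suc of_nat_mult of_nat_id)
      also have "\<dots> = (-1)^(k+n) * (of_nat n + 1/2 - of_nat k) * (2 * of_nat n + 2 - of_nat k)
          / (of_nat (fact p) * of_nat (fact (2*n+1-k)))"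
        by (simp del: of_nat_Suc)
      also have "\<dots> = cf k * (2 * of_nat n + 2 - of_nat k)"
        unfolding cf_def p by (simp add: mult_ac)
      finally have "cf k * (2 * of_nat n + 2 - of_nat k) = A2 k" ..
      then show "(cf k * (2 * of_nat n + 2 - of_nat k)) *c ?X k = A2 k *c ?X k" by (simp only:)
    qed
    also have "\<dots> = (\<Sum>k=0..2*n+1. A2 k *c ?X k)"
    proof (rule sum.mono_neutral_left)
      show "\<forall>k\<in>{0..2*n+1} - {1..2*n+1}. A2 k *c ?X k = 0"
      proof
        fix k assume "k \<in> {0..2*n+1} - {1..2*n+1}"
        then have "k = 0" by auto
        then show "A2 k *c ?X k = 0" by (simp add: A2_def)
      qed
    qed auto
    finally have 2: "(\<Sum>k\<in>{1..2*n+1}. (cf k * (2 * of_nat n + 2 - of_nat k)) *c ?X k) = (\<Sum>k=0..2*n+1. A2 k *c ?X k)" .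
    have C: "C k = A1 k + A2 k" for k
      by (simp add: A1_def A2_def C_def g_def algebra_simps diff_divide_distrib add_divide_distrib)
    show ?thesis
      unfolding sum.distrib 1 2 C cscale_left_distrib ..
  qed
  also have "\<dots> = (\<Sum>k=0..n. C k *c ?X k + C (2*n+1-k) *c ?X (2*n+1-k))"
    by (rule sum_reflect_half)
  also have "\<dots> = (\<Sum>k=0..n. (2 * ch k) *c P (2*n+1-k) (P k v) - (g k * c) *c v)"
  proof (intro sum.cong refl)
    fix k assume "k \<in> {0..n}"
    then have k: "k \<le> 2*n+1" "2*n+1-(2*n+1-k) = k" by auto
    let ?s = "(-1)^(k+n) :: complex" and ?f = "of_nat (fact k) * of_nat (fact (2*n+1-k)) :: complex"
    have sq: "?s * ?s = 1" by (simp flip: power_mult_distrib)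
    have sgn: "(-1::complex)^(2*n+1-k+n) = - ?s"
      using k by (simp add: minus_one_power_iff)
    have cn: "(of_nat (2*n+1-k) :: complex) = 2 * of_nat n + 1 - of_nat k" using k by (simp add: of_nat_diff)
    \<comment> \<open>Reordering costs the bracket of p_k and p_{2l-k}, whose factorials cancel the
      denominator of \<open>C k\<close> and leave \<open>g k\<close>.\<close>
    have X: "?X k = P (2*n+1-k) (P k v) - (?s * ?f * c) *c v"
    proof -
      have "pp_coeff n k (2*n+1-k) * c = - (?s * ?f * c)"
        unfolding pp_coeff_diag[OF k(1)] by simp
      then have "comm (P k) (P (2*n+1-k)) v = - ((?s * ?f * c) *c v)"
        using P_comm[OF v k(1), of "2*n+1-k"] by (simp only: diff_le_self cv.scale_minus_left)
      then show ?thesis by (simp only: diff_eq_eq) (simp only: minus_add_distrib diff_conv_add_uminus add.commute)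
    qed
    have gg: "g k - g (2*n+1-k) = 2 * (of_nat n + 1/2 - of_nat k)"
      unfolding g_def cn by (simp add: field_simps)
    have "C (2*n+1-k) = - ?s * g (2*n+1-k) / ?f" unfolding C_def k sgn by simp
    then have "C k + C (2*n+1-k) = ?s * (g k - g (2*n+1-k)) / ?f"
      by (simp add: C_def right_diff_distrib diff_divide_distrib)
    also have "\<dots> = 2 * ch k" unfolding gg ch_def by simp
    finally have CC: "C k + C (2*n+1-k) = 2 * ch k" .
    have "C k * (?s * ?f * c) = ?s * ?s * g k * c" by (simp add: C_def)
    then have Cg: "C k * (?s * ?f * c) = g k * c" unfolding sq by simp
    have "C k *c ?X k + C (2*n+1-k) *c ?X (2*n+1-k)
      = (C k + C (2*n+1-k)) *c P (2*n+1-k) (P k v) - (C k * (?s * ?f * c)) *c v"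
      unfolding X k(2) by (simp add: cv.scale_right_diff_distrib cscale_left_distrib cscale_cscale)
    then show "C k *c ?X k + C (2*n+1-k) *c ?X (2*n+1-k)
      = (2 * ch k) *c P (2*n+1-k) (P k v) - (g k * c) *c v"
      unfolding CC Cg .
  qed
  also have "(1/c) *c \<dots> = (2/c) *c (\<Sum>k=0..n. ch k *c P (2*n+1-k) (P k v)) - (\<Sum>k=0..n. g k) *c v"
    using c0 by (simp add: sum_subtractf cv.scale_right_diff_distrib cv.scale_sum_right cscale_cscale
        cv.scale_sum_left)
  finally show ?thesis by (simp add: \<phi>_GH quad_def sum_g)
qed

lemma all_gens_sl2: "x \<in> sl2_gens \<Longrightarrow> x \<in> all_gens n"
  by (simp add: all_gens_def)

lemma sl2_gens_mem: "GE \<in> sl2_gens" "GH \<in> sl2_gens" "GF \<in> sl2_gens"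
  by (simp_all add: sl2_gens_def)

lemmas \<phi>_sl2_lin = \<phi>_lin[OF all_gens_sl2]

lemma \<phi>_commute:
  assumes "lin_on V X" "\<And>k w. k \<le> 2*n+1 \<Longrightarrow> w \<in> V \<Longrightarrow> comm X (P k) w = 0"
    and "a \<in> opalg (act ` heis_gens n)" "v \<in> V"
  shows "X (a v) = a (X v)"
proof (rule opalg_commute[OF sub gen_lin assms(1) _ assms(3,4)])
  show "\<forall>s\<in>act ` heis_gens n. \<forall>v\<in>V. X (s v) = s (X v)"
    using assms(2) by (auto simp: heis_gens_def Z lin_on_scale[OF assms(1)] lin_on_in[OF assms(1)])
qed

text \<open>Phi is compatible with the brackets; this is checked on operators, with 1/c in place of
  a localisation at z.\<close>

theorem \<phi>_gt_mod: "gt_mod n V \<phi>"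
proof -
  have E: "comm (\<phi> GE) (P k) w = of_nat k *c P (k - 1) w" if "k \<le> 2*n+1" "w \<in> V" for k w
    using P_GE_comm[OF that(2,1)] by (simp add: algebra_simps)
  have F: "comm (\<phi> GF) (P k) w = of_nat (2*n+1-k) *c P (k + 1) w" if "k \<le> 2*n+1" "w \<in> V" for k w
    using P_GF_comm[OF that(2,1)] by (simp add: algebra_simps)
  have H: "comm (\<phi> GH) (P k) w = (2 * (of_nat n + 1/2 - of_nat k)) *c P k w" if "k \<le> 2*n+1" "w \<in> V" for k w
    using P_GH_comm[OF that(2,1)] by (simp add: algebra_simps)
  have HE: "comm (\<phi> GH) (\<phi> GE) v = 2 *c \<phi> GE v" if "v \<in> V" for v
  proof -
    have "comm (\<phi> GH) (\<phi> GE) v = (4 * of_nat n + 2 - 2 * of_nat (2*n)) *c \<phi> GE v"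
      unfolding \<phi>_GE by (rule GH_quad_comm[OF \<phi>_sl2_lin[OF sl2_gens_mem(2)] that H]) auto
    then show ?thesis by simp
  qed
  have HF: "comm (\<phi> GH) (\<phi> GF) v = (-2) *c \<phi> GF v" if "v \<in> V" for v
  proof -
    have "comm (\<phi> GH) (\<phi> GF) v = (4 * of_nat n + 2 - 2 * of_nat (2*n+2)) *c \<phi> GF v"
      unfolding \<phi>_GF by (rule GH_quad_comm[OF \<phi>_sl2_lin[OF sl2_gens_mem(2)] that H]) auto
    then show ?thesis by (simp add: algebra_simps)
  qed
  have EF: "comm (\<phi> GE) (\<phi> GF) v = \<phi> GH v" if "v \<in> V" for v
    by (rule GE_GF_comm[OF \<phi>_sl2_lin[OF sl2_gens_mem(1)] that E])
  have xZ: "comm (\<phi> x) (\<phi> GZ) v = 0" if "x \<in> sl2_gens" "v \<in> V" for x v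
    using \<phi>_sl2_lin[OF that(1)] that(2) by (simp add: Z lin_on_in lin_on_scale)
  have "heis_mod n V \<phi>"
    using mod unfolding heis_mod_def by (auto simp: heis_gens_def)
  moreover have "sl2_mod V \<phi>"
    unfolding sl2_mod_def using sub \<phi>_sl2_lin HE HF EF by blast
  ultimately show ?thesis
    unfolding gt_mod_def \<phi>_GP using E F H xZ by blast
qed

end

section \<open>Tensor products of modules\<close>

lemma linear_functional_extend:
  fixes B :: "'v::cvec set" and f :: "'v \<Rightarrow> complex"
  assumes "cv.independent B"
  shows "\<exists>L. (\<forall>u w. L (u + w) = L u + L w) \<and> (\<forall>a u. L (a *c u) = a * L u) \<and> (\<forall>b\<in>B. L b = f b)"
proof -
  \<comment> \<open>\<open>complex\<close> is not made an instance of \<open>cvec\<close>, so its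
    vector space structure is supplied directly.\<close>
  interpret c1: vector_space "(*) :: complex \<Rightarrow> complex \<Rightarrow> complex"
    by unfold_locales (simp_all add: algebra_simps)
  interpret vp: vector_space_pair "cscale :: complex \<Rightarrow> 'v \<Rightarrow> 'v" "(*) :: complex \<Rightarrow> complex \<Rightarrow> complex" ..
  obtain L where L: "Vector_Spaces.linear cscale (*) L" "\<forall>b\<in>B. L b = f b"
    using vp.linear_independent_extend[OF assms] by blast
  then interpret L: Vector_Spaces.linear "cscale :: complex \<Rightarrow> 'v \<Rightarrow> 'v" "(*)" L by simp
  show ?thesis using L(2) L.add L.scale by blast
qed

text \<open>Independence is required of the family and not of its range, so it also forces
  \<open>e\<close> to be injective. The family in view consists of the products of two
  bases.\<close>

lemma family_functional_extend:
  fixes e :: "'i \<Rightarrow> 'v::cvec" and f :: "'i \<Rightarrow> complex"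
  assumes ind: "\<And>t r i. finite t \<Longrightarrow> t \<subseteq> I \<Longrightarrow> (\<Sum>i\<in>t. r i *c e i) = 0 \<Longrightarrow> i \<in> t \<Longrightarrow> r i = 0"
  shows "\<exists>L. (\<forall>u w. L (u + w) = L u + L w) \<and> (\<forall>a u. L (a *c u) = a * L u) \<and> (\<forall>i\<in>I. L (e i) = f i)"
proof -
  have inj: "inj_on e I"
  proof (rule inj_onI, rule ccontr)
    fix i j assume "i \<in> I" "j \<in> I" "e i = e j" "i \<noteq> j"
    then show False using ind[of "{i, j}" "\<lambda>k. if k = i then 1 else -1" i] by auto
  qed
  have "cv.independent (e ` I)"
    unfolding cv.independent_explicit_module
  proof (intro allI impI)
    fix t u v assume t: "finite t" "t \<subseteq> e ` I" "(\<Sum>v\<in>t. u v *c v) = 0" "v \<in> t"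
    obtain J where J: "J \<subseteq> I" "t = e ` J" using t(2) by (meson subset_imageE)
    have injJ: "inj_on e J" using inj J(1) by (rule inj_on_subset)
    have "finite J" using t(1) J(2) injJ by (metis finite_imageD)
    moreover have "(\<Sum>i\<in>J. u (e i) *c e i) = 0" using t(3) unfolding J(2) by (simp add: sum.reindex injJ)
    moreover obtain i where "i \<in> J" "v = e i" using t(4) J(2) by blast
    ultimately show "u v = 0" using ind[of J "\<lambda>i. u (e i)" i] J(1) by simp
  qed
  from linear_functional_extend[OF this, of "\<lambda>v. f (the_inv_into I e v)"] show ?thesis
    by (simp add: the_inv_into_f_f[OF inj])
qed

locale bilin =
  fixes M :: "'m::cvec set" and N :: "'n::cvec set" and tp :: "'m \<Rightarrow> 'n \<Rightarrow> 't::cvec"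
  assumes subM: "csubspace M" and subN: "csubspace N" and bil: "bilin_on M N tp"
begin

lemma add_left: "m1 \<in> M \<Longrightarrow> m2 \<in> M \<Longrightarrow> n \<in> N \<Longrightarrow> tp (m1 + m2) n = tp m1 n + tp m2 n"
  using bil unfolding bilin_on_def by blast

lemma scale_left: "m \<in> M \<Longrightarrow> n \<in> N \<Longrightarrow> tp (a *c m) n = a *c tp m n"
  using bil unfolding bilin_on_def by blast

lemma add_right: "m \<in> M \<Longrightarrow> n1 \<in> N \<Longrightarrow> n2 \<in> N \<Longrightarrow> tp m (n1 + n2) = tp m n1 + tp m n2"
  using bil unfolding bilin_on_def by blast

lemma scale_right: "m \<in> M \<Longrightarrow> n \<in> N \<Longrightarrow> tp m (a *c n) = a *c tp m n"
  using bil unfolding bilin_on_def by blast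

lemma zero_left: "n \<in> N \<Longrightarrow> tp 0 n = 0"
  using scale_left[OF cv.subspace_0[OF subM], of n 0] by simp

lemma zero_right: "m \<in> M \<Longrightarrow> tp m 0 = 0"
  using scale_right[OF _ cv.subspace_0[OF subN], of m 0] by simp

lemma diff_left:
  assumes "m1 \<in> M" "m2 \<in> M" "n \<in> N"
  shows "tp (m1 - m2) n = tp m1 n - tp m2 n"
  using add_left[OF assms(1) cv.subspace_neg[OF subM assms(2)] assms(3)] scale_left[OF assms(2,3), of "-1"]
  by simp

lemma diff_right:
  assumes "m \<in> M" "n1 \<in> N" "n2 \<in> N"
  shows "tp m (n1 - n2) = tp m n1 - tp m n2"
  using add_right[OF assms(1,2) cv.subspace_neg[OF subN assms(3)]] scale_right[OF assms(1,3), of "-1"]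
  by simp

lemma sum_left: "(\<And>i. i \<in> I \<Longrightarrow> f i \<in> M) \<Longrightarrow> n \<in> N \<Longrightarrow> tp (\<Sum>i\<in>I. f i) n = (\<Sum>i\<in>I. tp (f i) n)"
  by (induction I rule: infinite_finite_induct)
    (simp_all add: zero_left add_left cv.subspace_sum[OF subM])

lemma sum_right: "(\<And>i. i \<in> I \<Longrightarrow> f i \<in> N) \<Longrightarrow> m \<in> M \<Longrightarrow> tp m (\<Sum>i\<in>I. f i) = (\<Sum>i\<in>I. tp m (f i))"
  by (induction I rule: infinite_finite_induct)
    (simp_all add: zero_right add_right cv.subspace_sum[OF subN])

lemma basis_expansion:
  assumes B: "B \<subseteq> M" "M \<subseteq> cspan B" and w: "w \<in> cspan {tp m n | m n. m \<in> M \<and> n \<in> N}"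
  shows "\<exists>F \<nu>. finite F \<and> F \<subseteq> B \<and> (\<forall>b\<in>F. \<nu> b \<in> N) \<and> w = (\<Sum>b\<in>F. tp b (\<nu> b))"
  using w
proof (induction w rule: cv.span_induct_alt)
  case base
  show ?case by (rule exI[of _ "{}"]) auto
next
  case (step a x y)
  then obtain m n where mn: "m \<in> M" "n \<in> N" "x = tp m n" by blast
  obtain F \<nu> where F: "finite F" "F \<subseteq> B" "\<forall>b\<in>F. \<nu> b \<in> N" "y = (\<Sum>b\<in>F. tp b (\<nu> b))"
    using step by blast
  obtain t r where t: "finite t" "t \<subseteq> B" "m = (\<Sum>b\<in>t. r b *c b)"
    using mn(1) B(2) unfolding cv.span_explicit by blast
  \<comment> \<open>The coefficients are extended by 0, so that both sums run over
    \<open>F \<union> t\<close>.\<close>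
  define \<nu>' where "\<nu>' b = (if b \<in> F then \<nu> b else 0) + (if b \<in> t then (a * r b) *c n else 0)" for b
  have inN: "(if b \<in> F then \<nu> b else 0) \<in> N" "(if b \<in> t then (a * r b) *c n else 0) \<in> N" for b
    using F(3) mn(2) by (auto simp: cv.subspace_0[OF subN] cv.subspace_scale[OF subN])
  have FtM: "b \<in> M" if "b \<in> F \<union> t" for b using that F(2) t(2) B(1) by blast
  have "x = (\<Sum>b\<in>t. r b *c tp b n)"
    unfolding mn(3) t(3) using FtM mn(2)
    by (subst sum_left) (auto simp: cv.subspace_scale[OF subM] scale_left)
  then have "a *c x = (\<Sum>b\<in>t. tp b ((a * r b) *c n))"
    using FtM mn(2) by (simp add: cv.scale_sum_right scale_right cscale_cscale)
  also have "\<dots> = (\<Sum>b\<in>F \<union> t. tp b (if b \<in> t then (a * r b) *c n else 0))"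
    by (rule sum.mono_neutral_cong_left) (use F(1) t(1) FtM in \<open>auto simp: zero_right\<close>)
  finally have x: "a *c x = (\<Sum>b\<in>F \<union> t. tp b (if b \<in> t then (a * r b) *c n else 0))" .
  have y: "y = (\<Sum>b\<in>F \<union> t. tp b (if b \<in> F then \<nu> b else 0))"
    unfolding F(4) by (rule sum.mono_neutral_cong_left) (use F(1) t(1) FtM in \<open>auto simp: zero_right\<close>)
  have "a *c x + y = (\<Sum>b\<in>F \<union> t. tp b (\<nu>' b))"
    unfolding x y sum.distrib[symmetric] \<nu>'_def
    by (rule sum.cong) (use add_right[OF FtM inN] in \<open>simp_all only: add.commute\<close>)
  moreover have "\<forall>b\<in>F \<union> t. \<nu>' b \<in> N" unfolding \<nu>'_def using inN cv.subspace_add[OF subN] by blast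
  ultimately show ?case using F(1,2) t(1,2) by (intro exI[of _ "F \<union> t"] exI[of _ \<nu>']) auto
qed

text \<open>Each generator in a word is replaced by its lift. Operators found by density on
  \<open>M\<close> thus become operators on the tensor product that move left factors only.\<close>

lemma opalg_lift:
  assumes S: "\<forall>s\<in>S. lin_on M s" and "\<forall>s\<in>S. \<exists>s'\<in>S'. \<forall>m\<in>M. \<forall>n\<in>N. s' (tp m n) = tp (s m) n"
    and "a \<in> opalg S"
  shows "\<exists>a'\<in>opalg S'. \<forall>m\<in>M. \<forall>n\<in>N. a' (tp m n) = tp (a m) n"
  using assms(3)
proof (induction a)
  case opalg_id
  show ?case by (rule bexI[OF _ opalg.opalg_id]) simp
next
  case (opalg_step s a)
  then obtain a' where a': "a' \<in> opalg S'" "\<forall>m\<in>M. \<forall>n\<in>N. a' (tp m n) = tp (a m) n" by blast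
  obtain s' where s': "s' \<in> S'" "\<forall>m\<in>M. \<forall>n\<in>N. s' (tp m n) = tp (s m) n" using assms(2) opalg_step by blast
  show ?case
    by (rule bexI[OF _ opalg.opalg_step[OF s'(1) a'(1)]])
      (use a'(2) s'(2) lin_on_in[OF opalg_lin[OF subM S opalg_step(2)]] in auto)
next
  case (opalg_add a b)
  then obtain a' b' where a': "a' \<in> opalg S'" "\<forall>m\<in>M. \<forall>n\<in>N. a' (tp m n) = tp (a m) n"
    and b': "b' \<in> opalg S'" "\<forall>m\<in>M. \<forall>n\<in>N. b' (tp m n) = tp (b m) n" by blast
  show ?case
    by (rule bexI[OF _ opalg.opalg_add[OF a'(1) b'(1)]])
      (use a'(2) b'(2) lin_on_in[OF opalg_lin[OF subM S opalg_add(1)]]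
        lin_on_in[OF opalg_lin[OF subM S opalg_add(2)]] in \<open>auto simp: add_left\<close>)
next
  case (opalg_scale a d)
  then obtain a' where a': "a' \<in> opalg S'" "\<forall>m\<in>M. \<forall>n\<in>N. a' (tp m n) = tp (a m) n" by blast
  show ?case
    by (rule bexI[OF _ opalg.opalg_scale[OF a'(1)]])
      (use a'(2) lin_on_in[OF opalg_lin[OF subM S opalg_scale(1)]] in \<open>auto simp: scale_left\<close>)
qed

end

section \<open>The diagonal action on a tensor product\<close>

lemma gens_simps [simp]:
  "GE \<in> all_gens n" "GF \<in> all_gens n" "GH \<in> all_gens n" "GZ \<in> all_gens n" "GZ \<in> heis_gens n"
  "GP k \<in> all_gens n \<longleftrightarrow> k \<le> 2*n+1" "GP k \<in> heis_gens n \<longleftrightarrow> k \<le> 2*n+1"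
  by (auto simp: all_gens_def sl2_gens_def heis_gens_def)

lemma all_gens_cases:
  assumes "x \<in> all_gens n"
  obtains "x \<in> sl2_gens" | "x \<in> heis_gens n"
  using assms by (auto simp: all_gens_def)

lemma gt_mod_lin: "gt_mod n V act \<Longrightarrow> x \<in> all_gens n \<Longrightarrow> lin_on V (act x)"
  unfolding gt_mod_def sl2_mod_def heis_mod_def all_gens_def by blast

lemma gt_mod_triv:
  assumes "sl2_mod N act"
  shows "gt_mod n N (triv_act act)"
proof -
  have N: "csubspace N" using assms by (simp add: sl2_mod_def)
  have z: "lin_on N (\<lambda>v. 0)" by (rule lin_onI) (simp_all add: cv.subspace_0[OF N])
  have t: "triv_act act GE = act GE" "triv_act act GH = act GH" "triv_act act GF = act GF"
      "triv_act act GZ = (\<lambda>v. 0)" "triv_act act (GP k) = (\<lambda>v. 0)" for k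
    by (simp_all add: triv_act_def fun_eq_iff)
  have L: "\<forall>x\<in>sl2_gens. lin_on N (act x)" using assms by (simp add: sl2_mod_def)
  have a0: "act GE 0 = 0" "act GH 0 = 0" "act GF 0 = 0"
    using L lin_on_zero[OF _ N] by (auto simp: sl2_gens_def)
  have "sl2_mod N (triv_act act)" using assms by (simp add: sl2_mod_def sl2_gens_def t)
  moreover have "heis_mod n N (triv_act act)"
    unfolding heis_mod_def by (auto simp: heis_gens_def t N z)
  ultimately show ?thesis unfolding gt_mod_def by (simp add: t a0 sl2_gens_def)
qed

locale tensor_action = bilin M N tp
  for M :: "'m::cvec set" and N :: "'n::cvec set" and tp :: "'m \<Rightarrow> 'n \<Rightarrow> 't::cvec" +
  fixes n :: nat and T actM actN and actT :: "gen \<Rightarrow> 't \<Rightarrow> 't"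
  assumes gM: "gt_mod n M actM" and gN: "gt_mod n N actN" and subT: "csubspace T"
    and T: "T = cspan {tp m v | m v. m \<in> M \<and> v \<in> N}"
    and linT: "x \<in> all_gens n \<Longrightarrow> lin_on T (actT x)"
    and act: "x \<in> all_gens n \<Longrightarrow> m \<in> M \<Longrightarrow> v \<in> N \<Longrightarrow> actT x (tp m v) = tp (actM x m) v + tp m (actN x v)"
begin

lemmas inM = lin_on_in[OF gt_mod_lin[OF gM]]
lemmas inN = lin_on_in[OF gt_mod_lin[OF gN]]

lemma tp_in: "m \<in> M \<Longrightarrow> v \<in> N \<Longrightarrow> tp m v \<in> T"
  unfolding T by (rule cv.span_base) blast

text \<open>Every defining bracket is a multiple of a single generator, so this covers them all; a
  vanishing bracket is \<open>d = 0\<close> with \<open>z = GZ\<close>.\<close>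

lemma relation:
  assumes x: "x \<in> all_gens n" and y: "y \<in> all_gens n" and z: "z \<in> all_gens n"
    and M: "\<And>m. m \<in> M \<Longrightarrow> comm (actM x) (actM y) m = d *c actM z m"
    and N: "\<And>v. v \<in> N \<Longrightarrow> comm (actN x) (actN y) v = d *c actN z v"
    and w: "w \<in> T"
  shows "comm (actT x) (actT y) w = d *c actT z w"
proof (rule cspan_induct_lin[of w "{tp m v | m v. m \<in> M \<and> v \<in> N}" T])
  show "w \<in> cspan {tp m v | m v. m \<in> M \<and> v \<in> N}" using w T by simp
  show "csubspace T" by (rule subT)
  show "{tp m v | m v. m \<in> M \<and> v \<in> N} \<subseteq> T" using tp_in by blast
  note X = linT[OF x] and Y = linT[OF y] and Z = linT[OF z]
  show "lin_on T (comm (actT x) (actT y))"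
    by (rule lin_onI)
      (simp_all add: cv.subspace_diff[OF subT] lin_on_in[OF X] lin_on_in[OF Y] lin_on_add[OF X] lin_on_add[OF Y]
        lin_on_scale[OF X] lin_on_scale[OF Y] cv.scale_right_diff_distrib)
  show "lin_on T (\<lambda>w. d *c actT z w)"
    by (rule lin_onI)
      (simp_all add: cv.subspace_scale[OF subT] lin_on_in[OF Z] lin_on_add[OF Z]
        lin_on_scale[OF Z] cscale_right_distrib cscale_cscale mult.commute)
  fix b assume "b \<in> {tp m v | m v. m \<in> M \<and> v \<in> N}"
  then obtain m v where b: "b = tp m v" "m \<in> M" "v \<in> N" by blast
  have two: "actT x (actT y (tp m v)) = tp (actM x (actM y m)) v + tp (actM y m) (actN x v)
      + (tp (actM x m) (actN y v) + tp m (actN x (actN y v)))"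
    if "x \<in> all_gens n" "y \<in> all_gens n" for x y
    using that b(2,3)
    by (simp add: act inM inN lin_on_add[OF linT] tp_in)
  \<comment> \<open>The mixed terms, with x on one factor and y on the other, cancel in the
    commutator.\<close>
  have "comm (actT x) (actT y) b = tp (comm (actM x) (actM y) m) v + tp m (comm (actN x) (actN y) v)"
    unfolding b(1) two[OF x y] two[OF y x]
    using b(2,3) x y by (simp add: diff_left diff_right inM inN)
  also have "\<dots> = d *c actT z b"
    unfolding b(1) using b(2,3) z by (simp add: M N act scale_left scale_right inM inN cscale_right_distrib)
  finally show "comm (actT x) (actT y) b = d *c actT z b" .
qed

lemma tensor_gt_mod: "gt_mod n T actT"
proof -
  note gMd = gM[unfolded gt_mod_def sl2_mod_def heis_mod_def]
  note gNd = gN[unfolded gt_mod_def sl2_mod_def heis_mod_def]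
  have sl2: "x \<in> all_gens n" if "x \<in> sl2_gens" for x using that by (simp add: all_gens_def)
  have he: "x \<in> all_gens n" if "x \<in> heis_gens n" for x using that by (simp add: all_gens_def)
  have "sl2_mod T actT"
    unfolding sl2_mod_def
  proof (intro conjI ballI)
    show "comm (actT GH) (actT GE) w = 2 *c actT GE w" if "w \<in> T" for w
      by (rule relation[OF _ _ _ _ _ that]) (use gMd gNd in auto)
    show "comm (actT GH) (actT GF) w = (-2) *c actT GF w" if "w \<in> T" for w
      by (rule relation[OF _ _ _ _ _ that]) (use gMd gNd in auto)
    have "comm (actT GE) (actT GF) w = 1 *c actT GH w" if "w \<in> T" for w
      by (rule relation[OF _ _ _ _ _ that]) (use gMd gNd in auto)
    then show "comm (actT GE) (actT GF) w = actT GH w" if "w \<in> T" for w using that by simp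
  qed (auto simp: subT linT sl2)
  moreover have "heis_mod n T actT"
    unfolding heis_mod_def
  proof (intro conjI ballI allI impI)
    show "comm (actT GZ) (actT (GP k)) w = 0" if "w \<in> T" "k \<le> 2*n+1" for w k
      using relation[of GZ "GP k" GZ 0 w] that gMd gNd by auto
    show "comm (actT (GP k)) (actT (GP k')) w = pp_coeff n k k' *c actT GZ w"
      if "w \<in> T" "k \<le> 2*n+1" "k' \<le> 2*n+1" for w k k'
      by (rule relation[OF _ _ _ _ _ that(1)]) (use that gMd gNd in auto)
  qed (auto simp: subT linT he)
  moreover have "comm (actT GH) (actT (GP k)) w = (2 * (of_nat n + 1/2 - of_nat k)) *c actT (GP k) w"
    if "w \<in> T" "k \<le> 2*n+1" for w k
    by (rule relation[OF _ _ _ _ _ that(1)]) (use that(2) gMd gNd in auto)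
  moreover have "comm (actT GE) (actT (GP k)) w = of_nat k *c actT (GP (k - 1)) w"
    if "w \<in> T" "k \<le> 2*n+1" for w k
    by (rule relation[OF _ _ _ _ _ that(1)]) (use that(2) gMd gNd in auto)
  moreover have "comm (actT GF) (actT (GP k)) w = of_nat (2*n+1-k) *c actT (GP (k + 1)) w"
    if "w \<in> T" "k \<le> 2*n+1" for w k
  proof (cases "k = 2*n+1")
    \<comment> \<open>\<open>GP (k + 1)\<close> is not among the generators here, and its
      coefficient is 0.\<close>
    case True
    then have "comm (actT GF) (actT (GP k)) w = 0 *c actT GZ w"
      by (intro relation[OF _ _ _ _ _ that(1)]) (use gMd gNd in auto)
    then show ?thesis using True by simp
  next
    case False
    then show ?thesis
      by (intro relation[OF _ _ _ _ _ that(1)]) (use that(2) gMd gNd in auto)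
  qed
  moreover have "comm (actT x) (actT GZ) w = 0" if "w \<in> T" "x \<in> sl2_gens" for w x
    using relation[of x GZ GZ 0 w] that gMd gNd sl2 by auto
  ultimately show ?thesis unfolding gt_mod_def by blast
qed

end

section \<open>Simplicity of the tensor product\<close>

lemma countable_gens: "countable (heis_gens n)"
  by (rule countable_finite) (simp add: heis_gens_def)

lemma simple_heis_ops:
  assumes "simple_heis_mod n M act"
  shows "simple_ops (act ` heis_gens n) M"
proof
  show "csubspace M" "M \<noteq> {0}" "countable (act ` heis_gens n)"
    using assms countable_gens by (auto simp: simple_heis_mod_def heis_mod_def simple_wrt_def)
  show "lin_on M s" if "s \<in> act ` heis_gens n" for s
    using assms that by (auto simp: simple_heis_mod_def heis_mod_def)
  show "W = {0} \<or> W = M"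
    if "csubspace W" "W \<subseteq> M" "\<And>s. s \<in> act ` heis_gens n \<Longrightarrow> s ` W \<subseteq> W" for W
    using assms that unfolding simple_heis_mod_def simple_wrt_def by blast
qed

lemma simple_tensor:
  fixes M :: "'m::cvec set" and N :: "'n::cvec set" and T :: "'t::cvec set"
  assumes M: "simple_heis_mod n M actM" and c: "c \<noteq> 0" "\<forall>v\<in>M. actM GZ v = c *c v"
    and N: "simple_sl2_mod N actN" and tp: "tensor_prod M N T tp"
    and lin: "\<forall>x\<in>all_gens n. lin_on T (actT x)"
    and act: "\<forall>x\<in>all_gens n. \<forall>m\<in>M. \<forall>v\<in>N.
         actT x (tp m v) = tp (phi_act n c actM x m) v + tp m (triv_act actN x v)"
  shows "simple_gt_mod n T actT"
proof -
  interpret M: simple_ops "actM ` heis_gens n" M using M by (rule simple_heis_ops)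
  interpret H: heis n M actM c
    by unfold_locales (use M c in \<open>auto simp: simple_heis_mod_def\<close>)
  have slN: "sl2_mod N actN" using N by (simp add: simple_sl2_mod_def)
  interpret tensor_action M N tp n T "phi_act n c actM" "triv_act actN" actT
    by unfold_locales
      (use tp lin act H.\<phi>_gt_mod gt_mod_triv[OF slN] in \<open>auto simp: tensor_prod_def\<close>)
  have N0: "N \<noteq> {0}" using N by (simp add: simple_sl2_mod_def simple_wrt_def)
  \<comment> \<open>The bilinear form f(m) g(v), with f and g equal to 1 at chosen vectors, lifts to
    a functional on \<open>T\<close> that is 1 on their tensor.\<close>
  have "T \<noteq> {0}"
  proof
    assume T0: "T = {0}"
    obtain m where m: "m \<in> M" "m \<noteq> 0" using M.nonzero cv.subspace_0[OF subM] by blast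
    obtain v where v: "v \<in> N" "v \<noteq> 0" using N0 cv.subspace_0[OF subN] by blast
    have "cv.independent {m}" "cv.independent {v}" using m v by simp_all
    then obtain f g where f: "\<forall>u w. f (u + w) = f u + f w" "\<forall>a u. f (a *c u) = a * f u" "f m = 1"
      and g: "\<forall>u w. g (u + w) = g u + g w" "\<forall>a u. g (a *c u) = a * g u" "g v = 1"
      using linear_functional_extend[of "{m}" "\<lambda>_. 1"] linear_functional_extend[of "{v}" "\<lambda>_. 1"]
      by auto
    have "bilin_form_on M N (\<lambda>m v. f m * g v)"
      unfolding bilin_form_on_def by (simp add: f g algebra_simps)
    then obtain L where L: "\<forall>a. \<forall>u\<in>T. L (a *c u) = a * (L u :: complex)" "\<forall>m\<in>M. \<forall>v\<in>N. L (tp m v) = f m * g v"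
      using tp unfolding tensor_prod_def by blast
    have "tp m v = 0" using tp_in[OF m(1) v(1)] T0 by simp
    moreover have "L 0 = 0" using L(1)[rule_format, of 0 0] T0 by simp
    ultimately show False using L(2) m v f g by fastforce
  qed
  moreover have "W = T" if W: "csubspace W" "W \<subseteq> T" "\<forall>x\<in>all_gens n. actT x ` W \<subseteq> W" "W \<noteq> {0}" for W
  proof -
    obtain w where w: "w \<in> W" "w \<noteq> 0" using W(4) cv.subspace_0[OF W(1)] by blast
    obtain B where B: "B \<subseteq> M" "cv.independent B" "M \<subseteq> cspan B"
      using cv.maximal_independent_subset by blast
    have "w \<in> cspan {tp m v | m v. m \<in> M \<and> v \<in> N}" using w(1) W(2) T by blast
    from basis_expansion[OF B(1,3) this] obtain F \<nu> where
      F: "finite F" "F \<subseteq> B" "\<forall>b\<in>F. \<nu> b \<in> N" "w = (\<Sum>b\<in>F. tp b (\<nu> b))" by blast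
    have FM: "F \<subseteq> M" using F(2) B(1) by blast
    obtain b0 where b0: "b0 \<in> F" "\<nu> b0 \<noteq> 0"
    proof -
      have "\<exists>b\<in>F. \<nu> b \<noteq> 0"
      proof (rule ccontr)
        assume "\<not> (\<exists>b\<in>F. \<nu> b \<noteq> 0)"
        then have "w = 0" unfolding F(4) using FM by (auto intro!: sum.neutral simp: zero_right)
        then show False using w by simp
      qed
      then show ?thesis using that by blast
    qed
    define N' where "N' = {v \<in> N. \<forall>m\<in>M. tp m v \<in> W}"
    have "tp m (\<nu> b0) \<in> W" if m: "m \<in> M" for m
    proof -
      have "cv.independent F" using B(2) F(2) by (rule cv.independent_mono)
      from M.density[OF F(1) FM this b0(1) m] obtain a where
        a: "a \<in> opalg (actM ` heis_gens n)" "a b0 = m" "\<forall>b\<in>F - {b0}. a b = 0" by blast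
      \<comment> \<open>The Heisenberg generators act by 0 on \<open>N\<close>, so on
        \<open>T\<close> they act through the first factor only.\<close>
      have "\<forall>s\<in>actM ` heis_gens n. \<exists>s'\<in>actT ` heis_gens n. \<forall>m\<in>M. \<forall>v\<in>N. s' (tp m v) = tp (s m) v"
      proof
        fix s assume "s \<in> actM ` heis_gens n"
        then obtain x where x: "x \<in> heis_gens n" "s = actM x" by blast
        have "actT x (tp m v) = tp (s m) v" if "m \<in> M" "v \<in> N" for m v
        proof -
          have "phi_act n c actM x m = s m" "triv_act actN x v = 0"
            using x by (auto simp: heis_gens_def triv_act_def)
          then show ?thesis using x that local.act[of x m v] by (simp add: all_gens_def zero_right)
        qed
        with x(1) show "\<exists>s'\<in>actT ` heis_gens n. \<forall>m\<in>M. \<forall>v\<in>N. s' (tp m v) = tp (s m) v" by blast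
      qed
      from opalg_lift[OF M.gen_lin this a(1)] obtain a' where
        a': "a' \<in> opalg (actT ` heis_gens n)" "\<forall>m\<in>M. \<forall>v\<in>N. a' (tp m v) = tp (a m) v" by blast
      have linT': "\<forall>s\<in>actT ` heis_gens n. lin_on T s" using linT by (auto simp: all_gens_def)
      have "a' w = (\<Sum>b\<in>F. a' (tp b (\<nu> b)))"
        unfolding F(4) by (rule lin_on_sum[OF opalg_lin[OF subT linT' a'(1)] subT]) (use FM F(3) tp_in in blast)
      also have "\<dots> = (\<Sum>b\<in>F. tp (a b) (\<nu> b))"
        by (rule sum.cong) (use FM F(3) a'(2) in auto)
      also have "\<dots> = (if b0 \<in> F then tp (a b0) (\<nu> b0) else 0)"
        by (rule sum_single[OF F(1)]) (use a(3) F(3) zero_left in auto)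
      finally have "a' w = tp m (\<nu> b0)" using b0(1) a(2) by simp
      moreover have "a' w \<in> W"
        by (rule opalg_stable[OF W(1) _ a'(1) w(1)]) (use W(3) in \<open>auto simp: all_gens_def\<close>)
      ultimately show ?thesis by simp
    qed
    then have "\<nu> b0 \<in> N'" using F(3) b0(1) by (simp add: N'_def)
    have "N' = {0} \<or> N' = N"
    proof -
      have "csubspace N'"
        by (rule cv.subspaceI)
          (auto simp: N'_def cv.subspace_0[OF subN] cv.subspace_add[OF subN] cv.subspace_scale[OF subN]
            zero_right add_right scale_right cv.subspace_0[OF W(1)] cv.subspace_add[OF W(1)]
            cv.subspace_scale[OF W(1)])
      moreover have "\<forall>x\<in>sl2_gens. actN x ` N' \<subseteq> N'"
      proof (intro ballI image_subsetI)
        fix x v assume x: "x \<in> sl2_gens" and v: "v \<in> N'"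
        then have xa: "x \<in> all_gens n" and tr: "triv_act actN x v = actN x v" and vN: "v \<in> N"
          by (auto simp: all_gens_def triv_act_def sl2_gens_def N'_def)
        have xv: "actN x v \<in> N" using inN[OF xa vN] tr by simp
        have "tp m (actN x v) \<in> W" if m: "m \<in> M" for m
        proof -
          \<comment> \<open>The diagonal action is solved for its second term; the subtracted vector
            lies in \<open>W\<close> because \<open>v\<close> is in \<open>N'\<close>.\<close>
          have "tp m (actN x v) = actT x (tp m v) - tp (phi_act n c actM x m) v"
            using local.act[OF xa m vN] tr by simp
          moreover have "actT x (tp m v) \<in> W" using W(3) xa v m by (auto simp: N'_def)
          moreover have "tp (phi_act n c actM x m) v \<in> W" using v inM[OF xa m] by (simp add: N'_def)
          ultimately show ?thesis using cv.subspace_diff[OF W(1)] by simp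
        qed
        with xv show "actN x v \<in> N'" by (simp add: N'_def)
      qed
      moreover have "N' \<subseteq> N" by (auto simp: N'_def)
      ultimately show ?thesis using N unfolding simple_sl2_mod_def simple_wrt_def by blast
    qed
    then have "N' = N" using \<open>\<nu> b0 \<in> N'\<close> b0(2) by auto
    then have "{tp m v | m v. m \<in> M \<and> v \<in> N} \<subseteq> W" by (auto simp: N'_def)
    then have "T \<subseteq> W" unfolding T using W(1) by (rule cv.span_minimal)
    with W(2) show ?thesis by blast
  qed
  ultimately show ?thesis
    unfolding simple_gt_mod_def simple_wrt_def using tensor_gt_mod by blast
qed

section \<open>The multiplicity space\<close>

locale heis_sub =
  fixes n :: nat and V :: "'v::cvec set" and act :: "gen \<Rightarrow> 'v \<Rightarrow> 'v" and c :: complex and M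
  assumes V: "simple_gt_mod n V act" and c0: "c \<noteq> 0" and Z: "\<And>v. v \<in> V \<Longrightarrow> act GZ v = c *c v"
    and MV: "M \<subseteq> V" and M: "simple_heis_mod n M act"
begin

abbreviation "A \<equiv> opalg (act ` heis_gens n)"

lemma gt: "gt_mod n V act"
  using V by (simp add: simple_gt_mod_def)

sublocale heis n V act c
  by unfold_locales (use gt c0 Z in \<open>auto simp: gt_mod_def\<close>)

sublocale M: simple_ops "act ` heis_gens n" M
  using M by (rule simple_heis_ops)

lemmas A_lin = opalg_lin[OF sub gen_lin]
lemmas A_in = lin_on_in[OF A_lin]
lemmas act_lin = gt_mod_lin[OF gt]

text \<open>On M \<otimes> N the operator \<open>\<phi> x\<close> is x \<otimes> 1, so this
  difference is 1 \<otimes> x: the action on the second factor, available in \<open>V\<close> before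
  any decomposition is known.\<close>

definition \<sigma> :: "gen \<Rightarrow> 'v \<Rightarrow> 'v" where
  "\<sigma> x v = act x v - \<phi> x v"

lemma act_eq: "act x v = \<phi> x v + \<sigma> x v"
  by (simp add: \<sigma>_def)

lemma \<sigma>_lin: "x \<in> all_gens n \<Longrightarrow> lin_on V (\<sigma> x)"
  using act_lin[of x] \<phi>_lin[of x] unfolding \<sigma>_def[abs_def]
  by (intro lin_onI) (simp_all add: lin_on_in cv.subspace_diff[OF sub] lin_on_add lin_on_scale
      cv.scale_right_diff_distrib)

lemma \<sigma>_in: "x \<in> sl2_gens \<Longrightarrow> v \<in> V \<Longrightarrow> \<sigma> x v \<in> V"
  by (rule lin_on_in[OF \<sigma>_lin[OF all_gens_sl2]])

text \<open>\<open>act\<close> and \<open>\<phi>\<close> are actions of the whole Lie algebra with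
  the same p_k, so their brackets with p_k agree.\<close>

lemma \<sigma>_P:
  assumes x: "x \<in> sl2_gens" and k: "k \<le> 2*n+1" and v: "v \<in> V"
  shows "comm (\<sigma> x) (P k) v = 0"
proof -
  have "comm (act x) (P k) v = comm (\<phi> x) (P k) v"
    using x k v gt \<phi>_gt_mod unfolding gt_mod_def \<phi>_GP sl2_gens_def by auto
  moreover have P\<sigma>: "P k (\<sigma> x v) = P k (act x v) - P k (\<phi> x v)"
    unfolding \<sigma>_def using all_gens_sl2[OF x]
    by (intro lin_on_diff[OF P_lin[OF k] sub]) (auto intro: lin_on_in[OF act_lin] lin_on_in[OF \<phi>_lin] v)
  ultimately show ?thesis unfolding P\<sigma> \<sigma>_def[of x "P k v"] by (simp add: algebra_simps)
qed

lemma \<sigma>_A: "x \<in> sl2_gens \<Longrightarrow> a \<in> A \<Longrightarrow> v \<in> V \<Longrightarrow> \<sigma> x (a v) = a (\<sigma> x v)"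
  using \<phi>_commute[OF \<sigma>_lin[OF all_gens_sl2] \<sigma>_P] by blast

text \<open>Since \<open>\<sigma> x\<close> commutes with \<open>\<phi> y\<close> and \<open>\<phi> x\<close> with \<open>\<sigma> y\<close>, the bracket of
  \<open>\<sigma> x\<close> and \<open>\<sigma> y\<close> is the difference of the brackets for \<open>act\<close> and for \<open>\<phi>\<close>.\<close>
lemma \<sigma>_comm:
  assumes x: "x \<in> sl2_gens" and y: "y \<in> sl2_gens" and v: "v \<in> V"
  shows "comm (\<sigma> x) (\<sigma> y) v = comm (act x) (act y) v - comm (\<phi> x) (\<phi> y) v"
proof -
  note xa = all_gens_sl2[OF x] and ya = all_gens_sl2[OF y]
  have 1: "act x (act y v) = \<phi> x (\<phi> y v) + \<phi> x (\<sigma> y v) + \<sigma> x (\<phi> y v) + \<sigma> x (\<sigma> y v)"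
    if "x \<in> sl2_gens" "y \<in> sl2_gens" for x y
    using that v by (simp add: act_eq lin_on_add[OF \<phi>_sl2_lin] lin_on_add[OF \<sigma>_lin[OF all_gens_sl2]]
        lin_on_in[OF \<phi>_sl2_lin] \<sigma>_in)
  have "\<sigma> x (\<phi> y v) = \<phi> y (\<sigma> x v)" "\<sigma> y (\<phi> x v) = \<phi> x (\<sigma> y v)"
    using x y xa ya v by (simp_all add: \<sigma>_A \<phi>_opalg)
  then show ?thesis unfolding 1[OF x y] 1[OF y x] by simp
qed

section \<open>Homomorphisms from M to V\<close>

definition m0 where "m0 = (SOME m. m \<in> M \<and> m \<noteq> 0)"

lemma m0: "m0 \<in> M" "m0 \<noteq> 0"
proof -
  have "\<exists>m. m \<in> M \<and> m \<noteq> 0" using M.nonzero cv.subspace_0[OF M.sub] by blast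
  then have "m0 \<in> M \<and> m0 \<noteq> 0" unfolding m0_def by (rule someI_ex)
  then show "m0 \<in> M" "m0 \<noteq> 0" by auto
qed

text \<open>A homomorphism from \<open>M\<close> to \<open>V\<close> is determined by the image of \<open>m0\<close>, so the
  multiplicity space Hom(M, V) is realised inside \<open>V\<close> as the set of these images;
  \<open>tp m u\<close> is the value at \<open>m\<close> of the homomorphism sending \<open>m0\<close> to \<open>u\<close>.\<close>
definition N where "N = {u \<in> V. \<forall>a\<in>A. a m0 = 0 \<longrightarrow> a u = 0}"

definition \<beta> where "\<beta> m = (SOME a. a \<in> A \<and> a m0 = m)"

definition tp where "tp m u = \<beta> m u"

lemma \<beta>:
  assumes "m \<in> M"
  shows "\<beta> m \<in> A" "\<beta> m m0 = m"
proof -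
  \<comment> \<open>\<open>ann {}\<close> is all of \<open>A\<close>, and it contains the identity,
    so \<open>m0\<close> generates \<open>M\<close>.\<close>
  have "(\<lambda>v. v) \<in> M.ann {}" by (simp add: M.ann_def opalg_id)
  from M.ann_cyclic[OF this m0 assms] have "\<exists>a. a \<in> A \<and> a m0 = m" by (auto simp: M.ann_def)
  then have "\<beta> m \<in> A \<and> \<beta> m m0 = m" unfolding \<beta>_def by (rule someI_ex)
  then show "\<beta> m \<in> A" "\<beta> m m0 = m" by auto
qed

lemma NV: "N \<subseteq> V"
  by (auto simp: N_def)

lemma subN: "csubspace N"
  by (rule cv.subspaceI)
    (auto simp: N_def cv.subspace_0[OF sub] cv.subspace_add[OF sub] cv.subspace_scale[OF sub]
      lin_on_zero[OF A_lin sub] lin_on_add[OF A_lin] lin_on_scale[OF A_lin])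

lemma m0_N: "m0 \<in> N"
  using m0 MV by (auto simp: N_def)

text \<open>The choice made by \<open>\<beta>\<close> does not matter: two operators with the same
  value at \<open>m0\<close> differ by one that kills \<open>m0\<close>, and hence
  \<open>u\<close>.\<close>

lemma tp_A:
  assumes a: "a \<in> A" and u: "u \<in> N"
  shows "tp (a m0) u = a u"
proof -
  have b: "\<beta> (a m0) \<in> A" "\<beta> (a m0) m0 = a m0" using \<beta>[OF M.alg_in[OF a m0(1)]] .
  have "(\<lambda>v. \<beta> (a m0) v - a v) \<in> A" using b(1) a by (rule opalg_diff)
  with u b(2) have "\<beta> (a m0) u - a u = 0" unfolding N_def by force
  then show ?thesis by (simp add: tp_def)
qed

lemma tp_in: "m \<in> M \<Longrightarrow> u \<in> N \<Longrightarrow> tp m u \<in> V"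
  using A_in[OF \<beta>(1)] NV by (auto simp: tp_def)

lemma tp_m0: "u \<in> N \<Longrightarrow> tp m0 u = u"
  using tp_A[OF opalg_id] by simp

text \<open>Both \<open>\<beta> (a m)\<close> and the composite of \<open>a\<close> with
  \<open>\<beta> m\<close> send \<open>m0\<close> to \<open>a m\<close>.\<close>

lemma tp_equivariant:
  assumes a: "a \<in> A" and m: "m \<in> M" and u: "u \<in> N"
  shows "tp (a m) u = a (tp m u)"
  using tp_A[OF opalg_comp[OF sub gen_lin a \<beta>(1)[OF m]] u] by (simp add: \<beta>(2)[OF m] tp_def)

sublocale bilin M N tp
proof unfold_locales
  show "csubspace M" by (rule M.sub)
  show "csubspace N" by (rule subN)
  have "tp (m1 + m2) u = tp m1 u + tp m2 u" if "u \<in> N" "m1 \<in> M" "m2 \<in> M" for u m1 m2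
    using tp_A[OF opalg_add[OF \<beta>(1)[OF that(2)] \<beta>(1)[OF that(3)]] that(1)]
    by (simp add: \<beta>(2) that tp_def)
  moreover have "tp (a *c m) u = a *c tp m u" if "u \<in> N" "m \<in> M" for u m a
    using tp_A[OF opalg_scale[OF \<beta>(1)[OF that(2)], of a] that(1)]
    by (simp add: \<beta>(2) that tp_def)
  ultimately show "bilin_on M N tp"
    unfolding bilin_on_def using NV
    by (simp add: tp_def lin_on_add[OF A_lin[OF \<beta>(1)]] lin_on_scale[OF A_lin[OF \<beta>(1)]] subset_iff)
qed

text \<open>Density sends \<open>b0\<close> to \<open>m0\<close> and the rest of \<open>F\<close> to
  0; applied to the relation this leaves \<open>tp m0 (\<nu> b0)\<close>, which is
  \<open>\<nu> b0\<close>.\<close>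

lemma tp_injective:
  assumes F: "finite F" "F \<subseteq> M" "cv.independent F" and \<nu>: "\<forall>b\<in>F. \<nu> b \<in> N"
    and rel: "(\<Sum>b\<in>F. tp b (\<nu> b)) = 0" and b0: "b0 \<in> F"
  shows "\<nu> b0 = 0"
proof -
  from M.density[OF F b0 m0(1)] obtain a where a: "a \<in> A" "a b0 = m0" "\<forall>b\<in>F - {b0}. a b = 0" by blast
  have "0 = a (\<Sum>b\<in>F. tp b (\<nu> b))" unfolding rel using lin_on_zero[OF A_lin[OF a(1)] sub] by simp
  also have "\<dots> = (\<Sum>b\<in>F. a (tp b (\<nu> b)))"
    by (rule lin_on_sum[OF A_lin[OF a(1)] sub]) (use F(2) \<nu> tp_in in blast)
  also have "\<dots> = (\<Sum>b\<in>F. tp (a b) (\<nu> b))"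
    by (rule sum.cong) (use F(2) \<nu> tp_equivariant[OF a(1)] in auto)
  also have "\<dots> = (if b0 \<in> F then tp (a b0) (\<nu> b0) else 0)"
    by (rule sum_single[OF F(1)]) (use a(3) \<nu> zero_left in auto)
  finally show ?thesis using b0 a(2) tp_m0 \<nu> by simp
qed

lemma \<sigma>_N:
  assumes x: "x \<in> sl2_gens" and u: "u \<in> N"
  shows "\<sigma> x u \<in> N"
proof -
  have "a (\<sigma> x u) = 0" if "a \<in> A" "a m0 = 0" for a
  proof -
    have "a u = 0" "u \<in> V" using that u by (auto simp: N_def)
    then show ?thesis
      using \<sigma>_A[OF x that(1), of u] lin_on_zero[OF \<sigma>_lin[OF all_gens_sl2[OF x]] sub] by simp
  qed
  then show ?thesis using u \<sigma>_in[OF x] by (simp add: N_def)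
qed

lemma \<sigma>_sl2_mod: "sl2_mod N \<sigma>"
proof -
  have L: "lin_on N (\<sigma> x)" if "x \<in> sl2_gens" for x
    using \<sigma>_lin[OF all_gens_sl2[OF that]] NV \<sigma>_N[OF that] by (auto simp: lin_on_def subset_iff)
  have s: "sl2_mod V act" "sl2_mod V \<phi>" using gt \<phi>_gt_mod by (simp_all add: gt_mod_def)
  have rel: "comm (\<sigma> x) (\<sigma> y) v = d *c \<sigma> z v"
    if "x \<in> sl2_gens" "y \<in> sl2_gens" "v \<in> N"
      "comm (act x) (act y) v = d *c act z v" "comm (\<phi> x) (\<phi> y) v = d *c \<phi> z v" for x y z v d
    using \<sigma>_comm[OF that(1,2) subsetD[OF NV that(3)]] that(4,5)
    by (simp only: \<sigma>_def[of z] cv.scale_right_diff_distrib)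
  have "comm (\<sigma> GH) (\<sigma> GE) v = 2 *c \<sigma> GE v" "comm (\<sigma> GH) (\<sigma> GF) v = (-2) *c \<sigma> GF v"
    "comm (\<sigma> GE) (\<sigma> GF) v = 1 *c \<sigma> GH v" if v: "v \<in> N" for v
    using s subsetD[OF NV v]
    by (intro rel[OF _ _ v]; simp add: sl2_gens_mem sl2_mod_def)+
  then show ?thesis unfolding sl2_mod_def using L subN by simp
qed

text \<open>For sl2 the part \<open>\<phi> x\<close> passes to \<open>m\<close> by equivariance,
  while \<open>\<sigma> x\<close> commutes with \<open>\<beta> m\<close> and passes to
  \<open>u\<close>.\<close>

lemma act_tp:
  assumes x: "x \<in> all_gens n" and m: "m \<in> M" and u: "u \<in> N"
  shows "act x (tp m u) = tp (\<phi> x m) u + tp m (triv_act \<sigma> x u)"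
proof (rule all_gens_cases[OF x])
  assume s: "x \<in> sl2_gens"
  then have t: "triv_act \<sigma> x u = \<sigma> x u" by (auto simp: triv_act_def sl2_gens_def)
  have "\<sigma> x (tp m u) = tp m (\<sigma> x u)"
    unfolding tp_def using \<sigma>_A[OF s \<beta>(1)[OF m]] u NV by blast
  then show ?thesis
    unfolding t act_eq[of x "tp m u"] using tp_equivariant[OF \<phi>_opalg[OF x] m u] by simp
next
  assume h: "x \<in> heis_gens n"
  then have "triv_act \<sigma> x u = 0" "\<phi> x m = act x m" by (auto simp: triv_act_def heis_gens_def)
  then show ?thesis using tp_equivariant[OF opalg_gen m u, of "act x"] h m by (simp add: zero_right)
qed

text \<open>With \<open>N' = N\<close> this is surjectivity of evaluation; for general
  \<open>N'\<close> it yields the simplicity of \<open>N\<close>.\<close>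

lemma span_stable:
  assumes N': "csubspace N'" "N' \<subseteq> N" "\<forall>x\<in>sl2_gens. \<sigma> x ` N' \<subseteq> N'" "N' \<noteq> {0}"
  shows "cspan {tp m u | m u. m \<in> M \<and> u \<in> N'} = V"
proof -
  let ?G = "{tp m u | m u. m \<in> M \<and> u \<in> N'}"
  have GV: "?G \<subseteq> V" using tp_in N'(2) by blast
  have WV: "cspan ?G \<subseteq> V" using GV sub by (rule cv.span_minimal)
  have "act x ` cspan ?G \<subseteq> cspan ?G" if x: "x \<in> all_gens n" for x
  proof
    fix w assume "w \<in> act x ` cspan ?G"
    then obtain v where "w = act x v" "v \<in> cspan ?G" by blast
    have "act x v \<in> cspan ?G \<and> v \<in> V"
      using \<open>v \<in> cspan ?G\<close>
    proof (induction v rule: cv.span_induct_alt)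
      case base
      show ?case by (simp add: lin_on_zero[OF act_lin[OF x] sub] cv.span_zero cv.subspace_0[OF sub])
    next
      case (step d y z)
      then obtain m u where mu: "m \<in> M" "u \<in> N'" "y = tp m u" by blast
      have "\<phi> x m \<in> M" using M.alg_in[OF \<phi>_opalg[OF x] mu(1)] .
      moreover have "triv_act \<sigma> x u \<in> N'"
        using N'(3) mu(2) cv.subspace_0[OF N'(1)] by (cases x) (auto simp: triv_act_def sl2_gens_def)
      ultimately have "act x y \<in> cspan ?G"
        unfolding mu(3) act_tp[OF x mu(1) subsetD[OF N'(2) mu(2)]]
        using mu by (intro cv.span_add cv.span_base) blast+
      moreover have "y \<in> V" using step GV by blast
      ultimately show ?case using step
        by (simp add: lin_on_add[OF act_lin[OF x]] lin_on_scale[OF act_lin[OF x]] cv.span_add cv.span_scale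
            cv.subspace_add[OF sub] cv.subspace_scale[OF sub])
    qed
    then show "w \<in> cspan ?G" using \<open>w = act x v\<close> by simp
  qed
  then have "cspan ?G = {0} \<or> cspan ?G = V"
    using V WV cv.subspace_span unfolding simple_gt_mod_def simple_wrt_def by blast
  moreover have "cspan ?G \<noteq> {0}"
  proof -
    obtain u where u: "u \<in> N'" "u \<noteq> 0" using N'(4) cv.subspace_0[OF N'(1)] by blast
    then have "tp m0 u \<in> cspan ?G" using m0(1) by (intro cv.span_base) blast
    then show ?thesis using u tp_m0 N'(2) by auto
  qed
  ultimately show ?thesis by blast
qed

text \<open>By \<open>span_stable\<close>, u = m0 \<otimes> u also has an expansion with
  coefficients in \<open>N'\<close>. In a basis of \<open>M\<close> containing \<open>m0\<close>,
  comparing the coefficients at \<open>m0\<close> puts \<open>u\<close> in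
  \<open>N'\<close>.\<close>

lemma \<sigma>_simple: "simple_sl2_mod N \<sigma>"
proof -
  have "N' = N" if N': "csubspace N'" "N' \<subseteq> N" "\<forall>x\<in>sl2_gens. \<sigma> x ` N' \<subseteq> N'" "N' \<noteq> {0}" for N'
  proof (rule antisym[OF N'(2)], rule subsetI)
    fix u assume u: "u \<in> N"
    interpret N': bilin M N' tp
      by unfold_locales (use N' bil M.sub in \<open>auto simp: bilin_on_def subset_iff\<close>)
    have "cv.independent {m0}" using m0 by simp
    then obtain B where B: "{m0} \<subseteq> B" "B \<subseteq> M" "cv.independent B" "M \<subseteq> cspan B"
      using cv.maximal_independent_subset_extend[of "{m0}" M] m0(1) by auto
    have "u \<in> cspan {tp m u | m u. m \<in> M \<and> u \<in> N'}"
      unfolding span_stable[OF N'] using u NV by blast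
    from N'.basis_expansion[OF B(2,4) this] obtain F \<nu> where
      F: "finite F" "F \<subseteq> B" "\<forall>b\<in>F. \<nu> b \<in> N'" "u = (\<Sum>b\<in>F. tp b (\<nu> b))" by blast
    define \<nu>' where "\<nu>' b = (if b \<in> F then \<nu> b else 0)" for b
    \<comment> \<open>The difference of the two expansions of \<open>u\<close>; the second one has
      the single coefficient \<open>u\<close> at \<open>m0\<close>.\<close>
    define \<mu> where "\<mu> b = \<nu>' b - (if b = m0 then u else 0)" for b
    have N'in: "\<nu>' b \<in> N'" for b using F(3) cv.subspace_0[OF N'(1)] by (auto simp: \<nu>'_def)
    have FM: "b \<in> M" if "b \<in> insert m0 F" for b using that F(2) B(2) m0(1) by blast
    have 1: "(\<Sum>b\<in>insert m0 F. tp b (\<nu>' b)) = u"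
      unfolding F(4)
      by (rule sum.mono_neutral_cong_right) (use F(1) m0(1) zero_right in \<open>auto simp: \<nu>'_def\<close>)
    have "(\<Sum>b\<in>insert m0 F. tp b (if b = m0 then u else 0)) = (if m0 \<in> insert m0 F then tp m0 (if m0 = m0 then u else 0) else 0)"
      by (rule sum_single) (use F(1) FM zero_right in auto)
    then have 2: "(\<Sum>b\<in>insert m0 F. tp b (if b = m0 then u else 0)) = u" using tp_m0[OF u] by simp
    have "(\<Sum>b\<in>insert m0 F. tp b (\<mu> b)) = (\<Sum>b\<in>insert m0 F. tp b (\<nu>' b) - tp b (if b = m0 then u else 0))"
      unfolding \<mu>_def
      by (rule sum.cong) (use N'in N'(2) u cv.subspace_0[OF subN] FM in \<open>auto simp: zero_right intro!: diff_right\<close>)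
    also have "\<dots> = 0" unfolding sum_subtractf 1 2 by simp
    finally have rel: "(\<Sum>b\<in>insert m0 F. tp b (\<mu> b)) = 0" .
    have "\<mu> m0 = 0"
    proof (rule tp_injective[OF _ _ _ _ rel])
      show "finite (insert m0 F)" "insert m0 F \<subseteq> M" using F(1) FM by auto
      show "cv.independent (insert m0 F)" using B(3) by (rule cv.independent_mono) (use B(1) F(2) in auto)
      show "\<forall>b\<in>insert m0 F. \<mu> b \<in> N"
        using N'in N'(2) u cv.subspace_0[OF subN] cv.subspace_diff[OF subN] by (auto simp: \<mu>_def)
    qed simp
    then have "u = \<nu>' m0" by (simp add: \<mu>_def)
    then show "u \<in> N'" using N'in by simp
  qed
  moreover have "N \<noteq> {0}" using m0_N m0(2) by auto
  ultimately show ?thesis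
    unfolding simple_sl2_mod_def simple_wrt_def using \<sigma>_sl2_mod by blast
qed

lemma V_span: "cspan {tp m u | m u. m \<in> M \<and> u \<in> N} = V"
  using m0_N m0(2) \<sigma>_N by (intro span_stable subN) auto

text \<open>Grouped by first components, the relation has coefficients in \<open>N\<close> that
  vanish by \<open>tp_injective\<close>; independence of \<open>BN\<close> then kills the
  scalars.\<close>

lemma tp_family_independent:
  assumes BM: "BM \<subseteq> M" "cv.independent BM" and BN: "BN \<subseteq> N" "cv.independent BN"
    and t: "finite t" "t \<subseteq> BM \<times> BN" and rel: "(\<Sum>i\<in>t. r i *c tp (fst i) (snd i)) = 0" and i: "i \<in> t"
  shows "r i = 0"
proof -
  define F where "F = fst ` t"
  define G where "G = snd ` t"
  define s where "s b d = (if (b, d) \<in> t then r (b, d) else 0)" for b d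
  define \<nu> where "\<nu> b = (\<Sum>d\<in>G. s b d *c d)" for b
  have FG: "finite F" "finite G" "F \<subseteq> BM" "G \<subseteq> BN" using t by (auto simp: F_def G_def)
  have GN: "s b d *c d \<in> N" if "d \<in> G" for b d
    using that FG BN(1) cv.subspace_scale[OF subN] by blast
  have "(\<Sum>b\<in>F. tp b (\<nu> b)) = (\<Sum>b\<in>F. \<Sum>d\<in>G. s b d *c tp b d)"
  proof (rule sum.cong)
    fix b assume "b \<in> F"
    then have b: "b \<in> M" using FG BM(1) by blast
    have "tp b (\<nu> b) = (\<Sum>d\<in>G. tp b (s b d *c d))" unfolding \<nu>_def by (rule sum_right[OF GN b])
    also have "\<dots> = (\<Sum>d\<in>G. s b d *c tp b d)"
      by (rule sum.cong) (use b FG(4) BN(1) in \<open>auto intro!: scale_right\<close>)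
    finally show "tp b (\<nu> b) = (\<Sum>d\<in>G. s b d *c tp b d)" .
  qed simp
  also have "\<dots> = (\<Sum>i\<in>F \<times> G. s (fst i) (snd i) *c tp (fst i) (snd i))"
    by (simp add: sum.cartesian_product case_prod_beta)
  also have "\<dots> = (\<Sum>i\<in>t. r i *c tp (fst i) (snd i))"
    by (rule sum.mono_neutral_cong_right)
      (use FG(1,2) in \<open>auto simp: s_def F_def G_def intro: rev_image_eqI\<close>)
  finally have "(\<Sum>b\<in>F. tp b (\<nu> b)) = 0" using rel by simp
  moreover have "cv.independent F" using BM(2) FG(3) by (rule cv.independent_mono)
  moreover have "\<forall>b\<in>F. \<nu> b \<in> N" unfolding \<nu>_def by (intro ballI cv.subspace_sum[OF subN] GN)
  moreover have "fst i \<in> F" "snd i \<in> G" using i by (auto simp: F_def G_def)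
  ultimately have "(\<Sum>d\<in>G. s (fst i) d *c d) = 0"
    using tp_injective[of F \<nu> "fst i"] FG BM(1) by (auto simp: \<nu>_def)
  then have "s (fst i) (snd i) = 0"
    using cv.independentD[OF BN(2) FG(2,4)] \<open>snd i \<in> G\<close> by blast
  then show ?thesis using i by (simp add: s_def)
qed

text \<open>A form is lifted by prescribing values on products of basis vectors; agreement then
  extends linearly in the second variable and after that in the first.\<close>

lemma tp_tensor_prod: "tensor_prod M N V tp"
proof -
  have "\<exists>L :: 'v \<Rightarrow> complex. (\<forall>u\<in>V. \<forall>w\<in>V. L (u + w) = L u + L w) \<and>
             (\<forall>a. \<forall>u\<in>V. L (a *c u) = a * L u) \<and> (\<forall>m\<in>M. \<forall>u\<in>N. L (tp m u) = b m u)"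
    if b: "bilin_form_on M N b" for b
  proof -
    obtain BM where BM: "BM \<subseteq> M" "cv.independent BM" "M \<subseteq> cspan BM"
      using cv.maximal_independent_subset by blast
    obtain BN where BN: "BN \<subseteq> N" "cv.independent BN" "N \<subseteq> cspan BN"
      using cv.maximal_independent_subset by blast
    have "\<exists>L. (\<forall>u w. L (u + w) = L u + L w) \<and> (\<forall>a u. L (a *c u) = a * L u)
        \<and> (\<forall>i\<in>BM \<times> BN. L (tp (fst i) (snd i)) = b (fst i) (snd i))"
      by (rule family_functional_extend) (rule tp_family_independent[OF BM(1,2) BN(1,2)])
    then obtain L where L: "\<And>u w. L (u + w) = L u + L w" "\<And>a u. L (a *c u) = a * L u"
      "\<And>m u. m \<in> BM \<Longrightarrow> u \<in> BN \<Longrightarrow> L (tp m u) = b m u" by fastforce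
    have L0: "L 0 = 0" using L(2)[of 0 0] by simp
    have b1: "b (m1 + m2) u = b m1 u + b m2 u" "b (a *c m1) u = a * b m1 u"
      if "m1 \<in> M" "m2 \<in> M" "u \<in> N" for m1 m2 u a using b that unfolding bilin_form_on_def by blast+
    have b2: "b m (u1 + u2) = b m u1 + b m u2" "b m (a *c u1) = a * b m u1"
      if "m \<in> M" "u1 \<in> N" "u2 \<in> N" for m u1 u2 a using b that unfolding bilin_form_on_def by blast+
    have b0: "b 0 u = 0" if "u \<in> N" for u
      using b1(2)[of 0 0 u 0] that cv.subspace_0[OF subM] by simp
    have b0': "b m 0 = 0" if "m \<in> M" for m
      using b2(2)[of m 0 0 0] that cv.subspace_0[OF subN] by simp
    have s1: "L (tp m u) = b m u" if m: "m \<in> BM" and u: "u \<in> N" for m u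
    proof -
      have mM: "m \<in> M" using m BM(1) by blast
      have "csubspace {u \<in> N. L (tp m u) = b m u}"
        by (rule cv.subspaceI)
          (auto simp: cv.subspace_0[OF subN] cv.subspace_add[OF subN] cv.subspace_scale[OF subN] mM
            zero_right add_right scale_right L(1,2) L0 b0' b2)
      moreover have "BN \<subseteq> {u \<in> N. L (tp m u) = b m u}" using L(3)[OF m] BN(1) by auto
      ultimately have "cspan BN \<subseteq> {u \<in> N. L (tp m u) = b m u}" by (intro cv.span_minimal)
      then show ?thesis using u BN(3) by blast
    qed
    have s2: "L (tp m u) = b m u" if m: "m \<in> M" and u: "u \<in> N" for m u
    proof -
      have "csubspace {m \<in> M. L (tp m u) = b m u}"
        by (rule cv.subspaceI)
          (auto simp: cv.subspace_0[OF subM] cv.subspace_add[OF subM] cv.subspace_scale[OF subM] u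
            zero_left add_left scale_left L(1,2) L0 b0 b1)
      moreover have "BM \<subseteq> {m \<in> M. L (tp m u) = b m u}" using s1[OF _ u] BM(1) by auto
      ultimately have "cspan BM \<subseteq> {m \<in> M. L (tp m u) = b m u}" by (intro cv.span_minimal)
      then show ?thesis using m BM(3) by blast
    qed
    show ?thesis using L(1,2) s2 by blast
  qed
  then show ?thesis
    unfolding tensor_prod_def V_span using subM subN sub tp_in bil by blast
qed

end

text \<open>In (i) \<open>T\<close> is any model of the tensor product, with the diagonal action
  prescribed on \<open>tp m v\<close>. In (ii) the isomorphism is expressed by \<open>V\<close>
  itself being a tensor product of \<open>M\<close> and \<open>N\<close> on which
  \<open>actV\<close> is the diagonal action.\<close>

theorem theorem3:
  fixes n :: nat
  shows
  "(\<forall>(M :: 'm::cvec set) actM c (N :: 'n::cvec set) actN (T :: 't::cvec set) tp actT.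
      simple_heis_mod n M actM \<and> c \<noteq> 0 \<and> (\<forall>v\<in>M. actM GZ v = c *c v) \<and>
      simple_sl2_mod N actN \<and>
      tensor_prod M N T tp \<and>
      (\<forall>x\<in>all_gens n. lin_on T (actT x)) \<and>
      (\<forall>x\<in>all_gens n. \<forall>m\<in>M. \<forall>v\<in>N.
         actT x (tp m v) = tp (phi_act n c actM x m) v + tp m (triv_act actN x v))
      \<longrightarrow> simple_gt_mod n T actT)
   \<and>
   (\<forall>(V :: 'v::cvec set) actV zdot M.
      simple_gt_mod n V actV \<and> zdot \<noteq> 0 \<and> (\<forall>v\<in>V. actV GZ v = zdot *c v) \<and>
      M \<subseteq> V \<and> simple_heis_mod n M actV
      \<longrightarrow> (\<exists>(N :: 'v set) actN (tp :: 'v \<Rightarrow> 'v \<Rightarrow> 'v).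
             simple_sl2_mod N actN \<and> tensor_prod M N V tp \<and>
             (\<forall>x\<in>all_gens n. \<forall>m\<in>M. \<forall>u\<in>N.
                actV x (tp m u) = tp (phi_act n zdot actV x m) u + tp m (triv_act actN x u))))"
proof (intro conjI allI impI)
  fix M :: "'m set" and actM c and N :: "'n set" and actN and T :: "'t set" and tp actT
  assume "simple_heis_mod n M actM \<and> c \<noteq> 0 \<and> (\<forall>v\<in>M. actM GZ v = c *c v) \<and>
      simple_sl2_mod N actN \<and> tensor_prod M N T tp \<and> (\<forall>x\<in>all_gens n. lin_on T (actT x)) \<and>
      (\<forall>x\<in>all_gens n. \<forall>m\<in>M. \<forall>v\<in>N.
         actT x (tp m v) = tp (phi_act n c actM x m) v + tp m (triv_act actN x v))"
  then show "simple_gt_mod n T actT" by (intro simple_tensor[of n M actM c N actN T tp actT]) blast+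
next
  fix V :: "'v set" and actV zdot M
  assume "simple_gt_mod n V actV \<and> zdot \<noteq> 0 \<and> (\<forall>v\<in>V. actV GZ v = zdot *c v) \<and>
      M \<subseteq> V \<and> simple_heis_mod n M actV"
  then interpret heis_sub n V actV zdot M by unfold_locales blast+
  show "\<exists>(N :: 'v set) actN (tp :: 'v \<Rightarrow> 'v \<Rightarrow> 'v).
             simple_sl2_mod N actN \<and> tensor_prod M N V tp \<and>
             (\<forall>x\<in>all_gens n. \<forall>m\<in>M. \<forall>u\<in>N.
                actV x (tp m u) = tp (phi_act n zdot actV x m) u + tp m (triv_act actN x u))"
    using \<sigma>_simple tp_tensor_prod act_tp by blast
qed

end
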